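(* Let $(c_i)_{i=1}^s$ be distinct and let $\{u_i\}_{i=1}^s$ satisfy the collocation condition. If the collocation parameters satisfy $$\int_{0}^1\prod_{i=1}^s(\xi-c_i)\,d\xi = 0,$$ then the corresponding $s$-stage FEPTRKN method has step order $p=s+1$ and stage order $r=s+1$.
   Context: Setting: the scalar initial value problem $y''(t)=f(t,y(t))$, $y(t_0)=y_0$, $y'(t_0)=y_0'$, on $[t_0,t_0+T]$, where $f$ is continuous in $t$, Lipschitz in $y$, and (for order statements) $f$ and the exact solution $y$ are sufficiently smooth. Notation: $\bm{c}=(c_1,\dots,c_s)^T$, $\bm{e}=(1,\dots,1)^T\in\mathbb{R}^s$; for a scalar function $v$, $v(\bm{e}t+\bm{c}h)=(v(t+c_1h),\dots,v(t+c_sh))^T$; $f(\bm{e}t+\bm{c}h,\bm{Y})=(f(t+c_1h,Y_1),\dots,f(t+c_sh,Y_s))^T$; $t_{n+1}=t_n+h$. Collocation condition: a set of sufficiently smooth functions $\{u_1,\dots,u_s\}$ satisfies the collocation condition if for any given $t\in[t_0,t_0+T)$ the $s\times s$ matrix $\bm{F}(t,h)=\big(u_1''(\bm{e}t+\bm{c}h),\dots,u_s''(\bm{e}t+\bm{c}h)\big)$ (columns) is nonsingular for almost every $h\in[0,h_{\max}]$, for some constant $h_{\max}>0$. FEPTRKN method (functionally-fitted explicit pseudo two-step Runge-Kutta-Nyström method) with respect to $\{u_i\}_{i=1}^s$: the coefficients $\bm{A}(t,h)\in\mathbb{R}^{s\times s}$, $\bm{b}(t,h),\bm{d}(t,h)\in\mathbb{R}^s$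 are defined, when $\bm{F}(t,h)$ is nonsingular and $h>0$, by requiring for all $i=1,\dots,s$ $$u_i(t+h)=u_i(t)+hu_i'(t)+h^2\bm{b}^T(t,h)u_i''(\bm{e}t+\bm{c}h),$$ $$u_i'(t+h)=u_i'(t)+h\bm{d}^T(t,h)u_i''(\bm{e}t+\bm{c}h),$$ $$u_i(\bm{e}t+\bm{c}h+\bm{e}h)=\bm{e}u_i(t+h)+h\bm{c}u_i'(t+h)+h^2\bm{A}(t,h)u_i''(\bm{e}t+\bm{c}h).$$ One step of the method maps $(y_n,y_n',\bm{Y}_n)$ to $$y_{n+1}=y_n+hy_n'+h^2\bm{b}^T(t_n,h)f(\bm{e}t_n+\bm{c}h,\bm{Y}_n),\qquad y_{n+1}'=y_n'+h\bm{d}^T(t_n,h)f(\bm{e}t_n+\bm{c}h,\bm{Y}_n),$$ $$\bm{Y}_{n+1}=\bm{e}y_{n+1}+h\bm{c}y_{n+1}'+h^2\bm{A}(t_n,h)f(\bm{e}t_n+\bm{c}h,\bm{Y}_n).$$ Orders: the method has step order $p=\min\{p_1,p_2\}$ and stage order $r=\min\{p_1,p_2,p_3\}$ if $$y(t_{n+1})-y_{n+1}=O(h^{p_1+1}),\quad y'(t_{n+1})-y'_{n+1}=O(h^{p_2+1}),\quad y(\bm{e}t_{n+1}+\bm{c}h)-\bm{Y}_{n+1}=O(h^{p_3+1}),$$ given that $y_n=y(t_n)$, $y_n'=y'(t_n)$, and $y(\bm{e}t_n+\bm{c}h)-\bm{Y}_n=O(h^{p_3+1})$. The symbols $O(\cdot)$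 refer to $h\to0^+$ (through values for which $\bm{F}(t_n,h)$ is nonsingular) with $t_n$ fixed.
   Formalization: Added: the Wronskian of u_1'',...,u_s'' is nonzero at t_n. Without it the claim fails: s=1, c_1=1/2, u=t^4/12, t_n=0 satisfies the collocation condition, but d=4/3 and for y''=1 the error in y' is -h/3. *)

theory Defs
  imports "HOL-Analysis.Analysis" "HOL-Library.Landau_Symbols"
begin

text \<open>
  The number of stages is the cardinality of the index type \<open>'s\<close>; stage vectors live in
  \<open>real ^ 's\<close>.
\<close>

definition nodes :: "real ^ 's \<Rightarrow> real \<Rightarrow> real \<Rightarrow> real ^ 's" where
  "nodes c t h = (\<chi> i. t + c $ i * h)"

definition at_nodes :: "(real \<Rightarrow> real) \<Rightarrow> real ^ 's \<Rightarrow> real \<Rightarrow> real \<Rightarrow> real ^ 's" where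
  "at_nodes v c t h = (\<chi> i. v (nodes c t h $ i))"

definition f_at_nodes ::
  "(real \<Rightarrow> real \<Rightarrow> real) \<Rightarrow> real ^ 's \<Rightarrow> real \<Rightarrow> real \<Rightarrow> real ^ 's \<Rightarrow> real ^ 's" where
  "f_at_nodes f c t h Y = (\<chi> i. f (nodes c t h $ i) (Y $ i))"

text \<open>
  Class $C^k$ on a set, with derivatives taken within the set, so that on a closed interval
  they are one-sided at the end points.
\<close>

definition C_k_on :: "nat \<Rightarrow> real set \<Rightarrow> (real \<Rightarrow> real) \<Rightarrow> bool" where
  "C_k_on k S g \<longleftrightarrow> (\<exists>D :: nat \<Rightarrow> real \<Rightarrow> real.
     (\<forall>t\<in>S. D 0 t = g t) \<and>
     (\<forall>j<k. \<forall>t\<in>S. (D j has_real_derivative D (Suc j) t) (at t within S)) \<and>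
     continuous_on S (D k))"

text \<open>
  In \<open>ivp_rhs\<close> the right-hand side is defined on the whole strip over the interval and the
  Lipschitz constant does not depend on the time. In \<open>ivp_solution\<close> the function \<open>y'\<close> is
  the derivative of \<open>y\<close>, again one-sided at the end points.
\<close>

definition ivp_rhs :: "real \<Rightarrow> real \<Rightarrow> (real \<Rightarrow> real \<Rightarrow> real) \<Rightarrow> bool" where
  "ivp_rhs t0 T f \<longleftrightarrow>
     (\<forall>x. continuous_on {t0..t0+T} (\<lambda>t. f t x)) \<and>
     (\<exists>L. \<forall>t\<in>{t0..t0+T}. L-lipschitz_on UNIV (f t))"

definition ivp_solution ::
  "real \<Rightarrow> real \<Rightarrow> (real \<Rightarrow> real \<Rightarrow> real) \<Rightarrow> real \<Rightarrow> real \<Rightarrow> (real \<Rightarrow> real) \<Rightarrow> (real \<Rightarrow> real) \<Rightarrow> bool" where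
  "ivp_solution t0 T f y0 y0' y y' \<longleftrightarrow>
     y t0 = y0 \<and> y' t0 = y0' \<and>
     (\<forall>t\<in>{t0..t0+T}. (y has_real_derivative y' t) (at t within {t0..t0+T}) \<and>
                      (y' has_real_derivative f t (y t)) (at t within {t0..t0+T}))"

text \<open>The $i$-th column of the matrix is $u_i''(\bm{e}t+\bm{c}h)$.\<close>

definition F_mat :: "('s \<Rightarrow> real \<Rightarrow> real) \<Rightarrow> real ^ 's \<Rightarrow> real \<Rightarrow> real \<Rightarrow> real ^ 's ^ 's" where
  "F_mat u c t h = (\<chi> j i. at_nodes (deriv (deriv (u i))) c t h $ j)"

definition collocation_condition ::
  "real \<Rightarrow> real \<Rightarrow> real ^ 's \<Rightarrow> ('s::finite \<Rightarrow> real \<Rightarrow> real) \<Rightarrow> bool" where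
  "collocation_condition t0 T c u \<longleftrightarrow>
     (\<exists>hmax>0. \<forall>t\<in>{t0..<t0+T}. AE h in lebesgue_on {0..hmax}. invertible (F_mat u c t h))"

definition fitted_coeffs ::
  "('s::finite \<Rightarrow> real \<Rightarrow> real) \<Rightarrow> real ^ 's \<Rightarrow> real \<Rightarrow> real \<Rightarrow>
   real ^ 's ^ 's \<Rightarrow> real ^ 's \<Rightarrow> real ^ 's \<Rightarrow> bool" where
  "fitted_coeffs u c t h A b d \<longleftrightarrow> (\<forall>i.
     u i (t + h) = u i t + h * deriv (u i) t
                   + h^2 * (b \<bullet> at_nodes (deriv (deriv (u i))) c t h) \<and>
     deriv (u i) (t + h) = deriv (u i) t + h * (d \<bullet> at_nodes (deriv (deriv (u i))) c t h) \<and>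
     at_nodes (u i) c (t + h) h = vec (u i (t + h)) + (h * deriv (u i) (t + h)) *\<^sub>R c
                   + h^2 *\<^sub>R (A *v at_nodes (deriv (deriv (u i))) c t h))"

definition fitted_method ::
  "real \<Rightarrow> real \<Rightarrow> ('s::finite \<Rightarrow> real \<Rightarrow> real) \<Rightarrow> real ^ 's \<Rightarrow>
   (real \<Rightarrow> real \<Rightarrow> real ^ 's ^ 's) \<Rightarrow> (real \<Rightarrow> real \<Rightarrow> real ^ 's) \<Rightarrow>
   (real \<Rightarrow> real \<Rightarrow> real ^ 's) \<Rightarrow> bool" where
  "fitted_method t0 T u c A b d \<longleftrightarrow>
     (\<forall>t\<in>{t0..<t0+T}. \<forall>h>0. invertible (F_mat u c t h) \<longrightarrow>
        fitted_coeffs u c t h (A t h) (b t h) (d t h))"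

text \<open>
  One step with step size \<open>h\<close> from \<open>(x, x', Y)\<close> at time \<open>t\<close>; the arguments \<open>A\<close>, \<open>b\<close>, \<open>d\<close> are
  the values of the coefficients at \<open>(t, h)\<close>.
\<close>

definition step_y ::
  "(real \<Rightarrow> real \<Rightarrow> real) \<Rightarrow> real ^ 's \<Rightarrow> real ^ 's \<Rightarrow> real \<Rightarrow> real \<Rightarrow> real \<Rightarrow> real \<Rightarrow> real ^ 's::finite \<Rightarrow> real" where
  "step_y f c b t h x x' Y = x + h * x' + h^2 * (b \<bullet> f_at_nodes f c t h Y)"

definition step_y' ::
  "(real \<Rightarrow> real \<Rightarrow> real) \<Rightarrow> real ^ 's \<Rightarrow> real ^ 's \<Rightarrow> real \<Rightarrow> real \<Rightarrow> real \<Rightarrow> real ^ 's::finite \<Rightarrow> real" where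
  "step_y' f c d t h x' Y = x' + h * (d \<bullet> f_at_nodes f c t h Y)"

definition step_Y ::
  "(real \<Rightarrow> real \<Rightarrow> real) \<Rightarrow> real ^ 's \<Rightarrow> real ^ 's ^ 's \<Rightarrow> real ^ 's \<Rightarrow> real ^ 's \<Rightarrow>
   real \<Rightarrow> real \<Rightarrow> real \<Rightarrow> real \<Rightarrow> real ^ 's::finite \<Rightarrow> real ^ 's" where
  "step_Y f c A b d t h x x' Y =
     vec (step_y f c b t h x x' Y) + (h * step_y' f c d t h x' Y) *\<^sub>R c
     + h^2 *\<^sub>R (A *v f_at_nodes f c t h Y)"

text \<open>
  Step sizes at which the method is defined and all points at which the exact solution is
  evaluated belong to the interval of integration. If all \<open>c $ i\<close> are nonnegative and \<open>t < t0 + T\<close>,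
  the interval conditions hold for every small enough positive step size.
\<close>

definition admissible_steps ::
  "real \<Rightarrow> real \<Rightarrow> ('s::finite \<Rightarrow> real \<Rightarrow> real) \<Rightarrow> real ^ 's \<Rightarrow> real \<Rightarrow> real set" where
  "admissible_steps t0 T u c t = {h. 0 < h \<and> invertible (F_mat u c t h) \<and>
     t + h \<in> {t0..t0+T} \<and>
     (\<forall>i. nodes c t h $ i \<in> {t0..t0+T} \<and> nodes c (t + h) h $ i \<in> {t0..t0+T})}"

text \<open>
  Step order \<open>p\<close> and stage order \<open>r\<close> at the fixed time \<open>t\<close>. The step starts from the exact
  values of \<open>y\<close> and \<open>y'\<close> at \<open>t\<close> and from any family of stage vectors \<open>Y h\<close> of the stated
  accuracy.
\<close>

definition has_orders_at ::
  "real \<Rightarrow> real \<Rightarrow> ('s::finite \<Rightarrow> real \<Rightarrow> real) \<Rightarrow> real ^ 's \<Rightarrow>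
   (real \<Rightarrow> real \<Rightarrow> real ^ 's ^ 's) \<Rightarrow> (real \<Rightarrow> real \<Rightarrow> real ^ 's) \<Rightarrow> (real \<Rightarrow> real \<Rightarrow> real ^ 's) \<Rightarrow>
   (real \<Rightarrow> real \<Rightarrow> real) \<Rightarrow> (real \<Rightarrow> real) \<Rightarrow> (real \<Rightarrow> real) \<Rightarrow> real \<Rightarrow> nat \<Rightarrow> nat \<Rightarrow> bool" where
  "has_orders_at t0 T u c A b d f y y' t p r \<longleftrightarrow>
     (\<exists>p1 p2 p3 :: nat. p = min p1 p2 \<and> r = min (min p1 p2) p3 \<and>
       (\<forall>Y :: real \<Rightarrow> real ^ 's.
         let H = at 0 within admissible_steps t0 T u c t in
         (\<lambda>h. norm (at_nodes y c t h - Y h)) \<in> O[H](\<lambda>h. h ^ (p3 + 1)) \<longrightarrow>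
         (\<lambda>h. y (t + h) - step_y f c (b t h) t h (y t) (y' t) (Y h)) \<in> O[H](\<lambda>h. h ^ (p1 + 1)) \<and>
         (\<lambda>h. y' (t + h) - step_y' f c (d t h) t h (y' t) (Y h)) \<in> O[H](\<lambda>h. h ^ (p2 + 1)) \<and>
         (\<lambda>h. norm (at_nodes y c (t + h) h
                - step_Y f c (A t h) (b t h) (d t h) t h (y t) (y' t) (Y h)))
            \<in> O[H](\<lambda>h. h ^ (p3 + 1))))"

text \<open>
  No nontrivial linear combination of the \<open>u i''\<close> vanishes at \<open>t\<close> to order \<open>s\<close>. Equivalently,
  the Wronskian of the \<open>u i''\<close> at \<open>t\<close> is nonzero. The collocation condition alone does not
  imply this at every \<open>t\<close>, and without it the order can drop: for $s = 1$, $c = 1/2$,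
  $u = (t - t_0)^4/12$, the coefficient $d(t_0,h)$ is $4/3$, and one step for $y'' = 1$ from
  $t_0$ has an error $h/3$ in $y'$.
\<close>

definition wronskian_nonzero_at :: "('s::finite \<Rightarrow> real \<Rightarrow> real) \<Rightarrow> real \<Rightarrow> bool" where
  "wronskian_nonzero_at u t \<longleftrightarrow>
     (\<forall>a :: 's \<Rightarrow> real.
        (\<forall>k<CARD('s). (\<Sum>i\<in>UNIV. a i * (deriv ^^ (k + 2)) (u i) t) = 0) \<longrightarrow> (\<forall>i. a i = 0))"

end

theory Submission
  imports Defs
begin

text \<open>
  Fix the time \<open>t\<close>. Since the Wronskian of the \<open>u i''\<close> does not vanish at \<open>t\<close>, for each \<open>k < s\<close> some
  linear combination $w_k$ of the \<open>u i\<close> satisfies $w_k''(t+\tau) = \tau^k/k! + O(\tau^s)$. The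
  coefficients are exact on $w_k$, so they satisfy the classical polynomial conditions up to $O(h)$;
  as the Vandermonde matrix of the nodes is invertible, they stay bounded as \<open>h\<close> tends to 0.
  Subtracting a combination of the \<open>u i\<close> from the solution leaves a function whose second
  derivative is $a\tau^s/s! + O(\tau^{s+1})$, and this has the same defects. They are of order
  $h^{s+2}$ for the two formulas with the factor $h^2$. For \<open>y'\<close>, which has only a factor $h$, one
  power is gained because $\prod_i(x-c_i)$ vanishes at the nodes and has integral zero, so the
  weights also integrate $\xi^s$ correctly up to $O(h)$.
\<close>

section \<open>Derivative sequences and Taylor expansion at a fixed point\<close>

text \<open>The derivatives are carried as an explicit sequence, constrained only at indices up to
  \<open>n\<close>. This allows one-sided derivatives at the end points of a closed interval, where
  \<open>deriv\<close> depends on values outside it, and makes differentiation a shift of the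
  index.\<close>

definition jet_on :: "nat \<Rightarrow> real set \<Rightarrow> (nat \<Rightarrow> real \<Rightarrow> real) \<Rightarrow> bool" where
  "jet_on n X D \<longleftrightarrow>
     (\<forall>j<n. \<forall>x\<in>X. (D j has_real_derivative D (Suc j) x) (at x within X)) \<and>
     continuous_on X (D n)"

text \<open>These are the values of \<tau>^k/k! at the nodes for step size 1. For
  \<open>k < CARD('s)\<close> they are the columns of the Vandermonde matrix, scaled so that they
  match the second derivative of $w_k$.\<close>

definition monomial_vec :: "real ^ 's \<Rightarrow> nat \<Rightarrow> real ^ 's" where
  "monomial_vec c k = (\<chi> i. c $ i ^ k / fact k)"

lemma C_k_on_iff_jet_on: "C_k_on n X g \<longleftrightarrow> (\<exists>D. (\<forall>x\<in>X. D 0 x = g x) \<and> jet_on n X D)"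
  unfolding C_k_on_def jet_on_def by blast

lemma jet_on_continuous:
  assumes "jet_on n X D" "j \<le> n"
  shows "continuous_on X (D j)"
  using assms unfolding jet_on_def
  by (metis DERIV_continuous continuous_on_eq_continuous_within le_neq_implies_less)

lemma jet_on_le:
  assumes "jet_on n X D" "m \<le> n"
  shows "jet_on m X D"
  using jet_on_continuous[OF assms] assms unfolding jet_on_def by auto

lemma jet_on_shift:
  assumes "jet_on (n + k) X D"
  shows "jet_on n X (\<lambda>j. D (j + k))"
  using assms unfolding jet_on_def by auto

lemma jet_on_subset: "jet_on n X D \<Longrightarrow> Z \<subseteq> X \<Longrightarrow> jet_on n Z D"
  unfolding jet_on_def by (meson DERIV_subset continuous_on_subset subsetD)

lemma jet_on_zero: "jet_on n X (\<lambda>_ _. 0)"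
  unfolding jet_on_def by auto

lemma jet_on_diff_sum:
  assumes "jet_on n X D" "\<And>i. jet_on n X (U i)"
  shows "jet_on n X (\<lambda>j x. D j x - (\<Sum>i\<in>J. a i * U i j x))"
  using assms unfolding jet_on_def
  by (auto intro!: derivative_eq_intros continuous_intros sum.cong simp: mult.commute)

text \<open>On an open set the derivative within the set is the two-sided one, so by induction any
  witness of \<open>C_k_on\<close> agrees there with the iterates of \<open>deriv\<close>. This
  brings in the \<open>u i\<close>, whose fitting equations and Wronskian are written with
  \<open>deriv\<close>.\<close>

lemma C_k_on_open_jet:
  assumes "open X" "C_k_on n X g"
  shows "jet_on n X (\<lambda>j. (deriv ^^ j) g)"
proof -
  obtain D where D0: "\<forall>x\<in>X. D 0 x = g x" and D: "jet_on n X D"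
    using assms(2) C_k_on_iff_jet_on by blast
  have eq: "\<forall>x\<in>X. (deriv ^^ j) g x = D j x" if "j \<le> n" for j
    using that
  proof (induction j)
    case 0
    then show ?case using D0 by simp
  next
    case (Suc j)
    show ?case
    proof
      fix x assume x: "x \<in> X"
      have "(D j has_real_derivative D (Suc j) x) (at x)"
        using D Suc.prems x assms(1) unfolding jet_on_def by (metis at_within_open less_eq_Suc_le)
      then have "((deriv ^^ j) g has_real_derivative D (Suc j) x) (at x)"
        by (rule has_field_derivative_transform_within_open[OF _ assms(1) x]) (use Suc in auto)
      then show "(deriv ^^ Suc j) g x = D (Suc j) x"
        by (simp add: DERIV_imp_deriv)
    qed
  qed
  show ?thesis
    unfolding jet_on_def
  proof (intro conjI allI impI ballI)
    fix j x assume j: "j < n" and x: "x \<in> X"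
    have "(D j has_real_derivative D (Suc j) x) (at x)"
      using D j x assms(1) unfolding jet_on_def by (metis at_within_open)
    then have "((deriv ^^ j) g has_real_derivative D (Suc j) x) (at x)"
      by (rule has_field_derivative_transform_within_open[OF _ assms(1) x]) (use eq j in auto)
    then show "((deriv ^^ j) g has_real_derivative (deriv ^^ Suc j) g x) (at x within X)"
      using eq[of "Suc j"] j x by (auto intro: has_field_derivative_at_within)
  next
    show "continuous_on X ((deriv ^^ n) g)"
      using jet_on_continuous[OF D, of n] eq[of n] by (auto cong: continuous_on_cong)
  qed
qed

text \<open>The derivative \<open>D (Suc n)\<close> is bounded, being continuous on a compact
  interval, and the Taylor remainder at distance \<open>\<gamma> * h\<close> scales like
  \<open>h ^ Suc n\<close>.\<close>

lemma jet_taylor_bigo: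
  fixes a b :: real
  assumes D: "jet_on (Suc n) {a..b} D" and t: "t \<in> {a..b}"
    and inI: "eventually (\<lambda>h. t + \<gamma> * h \<in> {a..b}) F"
  shows "(\<lambda>h. D 0 (t + \<gamma> * h) - (\<Sum>j\<le>n. D j t * (\<gamma> * h) ^ j / fact j)) \<in> O[F](\<lambda>h. h ^ Suc n)"
proof -
  have "compact (D (Suc n) ` {a..b})"
    using jet_on_continuous[OF D] by (intro compact_continuous_image) auto
  then obtain B where B: "\<And>x. x \<in> {a..b} \<Longrightarrow> norm (D (Suc n) x) \<le> B"
    by (meson bounded_iff compact_imp_bounded imageI)
  show ?thesis
  proof (rule bigoI, rule eventually_mono[OF inI])
    fix h assume h: "t + \<gamma> * h \<in> {a..b}"
    have "norm (D 0 (t + \<gamma> * h) - (\<Sum>j\<le>n. D j t * (t + \<gamma> * h - t) ^ j / fact j))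
        \<le> B * norm (t + \<gamma> * h - t) ^ Suc n / fact n"
      using field_Taylor[where f = D and n = n and B = B and S = "{a..b}", OF _ _ B t h] D
      by (auto simp: jet_on_def)
    also have "\<dots> = B * \<bar>\<gamma>\<bar> ^ Suc n / fact n * norm (h ^ Suc n)"
      by (simp add: abs_mult power_mult_distrib power_abs)
    finally show "norm (D 0 (t + \<gamma> * h) - (\<Sum>j\<le>n. D j t * (\<gamma> * h) ^ j / fact j))
        \<le> B * \<bar>\<gamma>\<bar> ^ Suc n / fact n * norm (h ^ Suc n)" by simp
  qed
qed

text \<open>When the second derivative vanishes at \<open>t\<close> to order \<open>k\<close>, its
  Taylor sum of degree \<open>k\<close> keeps only the last term; the sums for \<open>D 1\<close>
  and \<open>D 0\<close> keep in addition their constant and affine parts. The three claims are one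
  expansion applied to sequences shifted by 0, 1 and 2.\<close>

lemma jet_flat_bigo:
  fixes a b :: real
  assumes D: "jet_on (k + 3) {a..b} D" and flat: "\<And>j. j < k \<Longrightarrow> D (j + 2) t = 0"
    and t: "t \<in> {a..b}" and inI: "eventually (\<lambda>h. t + \<gamma> * h \<in> {a..b}) F"
  shows "(\<lambda>h. D 0 (t + \<gamma> * h) - D 0 t - D 1 t * (\<gamma> * h)
            - D (k + 2) t * (\<gamma> * h) ^ (k + 2) / fact (k + 2)) \<in> O[F](\<lambda>h. h ^ (k + 3))"
    and "(\<lambda>h. D 1 (t + \<gamma> * h) - D 1 t
            - D (k + 2) t * (\<gamma> * h) ^ (k + 1) / fact (k + 1)) \<in> O[F](\<lambda>h. h ^ (k + 2))"
    and "(\<lambda>h. D 2 (t + \<gamma> * h) - D (k + 2) t * (\<gamma> * h) ^ k / fact k) \<in> O[F](\<lambda>h. h ^ (k + 1))"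
proof -
  have flat_sum: "(\<Sum>j\<le>k. D (j + 2) t * e j) = D (k + 2) t * e k" for e
    using flat by (simp add: lessThan_Suc_atMost[symmetric])
  show "(\<lambda>h. D 2 (t + \<gamma> * h) - D (k + 2) t * (\<gamma> * h) ^ k / fact k) \<in> O[F](\<lambda>h. h ^ (k + 1))"
  proof -
    have "jet_on (Suc k) {a..b} (\<lambda>j. D (j + 2))"
      using D by (intro jet_on_shift) (simp add: eval_nat_numeral)
    from jet_taylor_bigo[OF this t inI] show ?thesis
      using flat_sum[of "\<lambda>j. (\<gamma> * h) ^ j / fact j" for h] by (simp add: add.commute numeral_2_eq_2)
  qed
  show "(\<lambda>h. D 1 (t + \<gamma> * h) - D 1 t
            - D (k + 2) t * (\<gamma> * h) ^ (k + 1) / fact (k + 1)) \<in> O[F](\<lambda>h. h ^ (k + 2))"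
  proof -
    have "jet_on (Suc (Suc k)) {a..b} (\<lambda>j. D (j + 1))"
      using D by (intro jet_on_shift) (simp add: eval_nat_numeral)
    from jet_taylor_bigo[OF this t inI] show ?thesis
      using flat_sum[of "\<lambda>j. (\<gamma> * h) ^ Suc j / fact (Suc j)" for h]
      by (simp add: sum.atMost_Suc_shift diff_diff_eq del: power_Suc fact_Suc sum.atMost_Suc)
  qed
  show "(\<lambda>h. D 0 (t + \<gamma> * h) - D 0 t - D 1 t * (\<gamma> * h)
            - D (k + 2) t * (\<gamma> * h) ^ (k + 2) / fact (k + 2)) \<in> O[F](\<lambda>h. h ^ (k + 3))"
  proof -
    have "jet_on (Suc (Suc (Suc k))) {a..b} D"
      using D by (simp add: eval_nat_numeral)
    from jet_taylor_bigo[OF this t inI] show ?thesis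
      using flat_sum[of "\<lambda>j. (\<gamma> * h) ^ Suc (Suc j) / fact (Suc (Suc j))" for h]
      by (simp add: sum.atMost_Suc_shift diff_diff_eq add.assoc numeral_3_eq_3
           del: power_Suc fact_Suc sum.atMost_Suc)
  qed
qed

section \<open>Square linear systems and the Vandermonde matrix\<close>

lemma bij_betw_UNIV_lessThan:
  obtains e :: "'s::finite \<Rightarrow> nat" where "bij_betw e UNIV {..<CARD('s)}"
  using ex_bij_betw_finite_nat[of "UNIV :: 's set"] that by (auto simp: atLeast0LessThan)

text \<open>An injective endomorphism of a finite-dimensional space is surjective; the enumeration
  \<open>e\<close> turns the order index \<open>k\<close> into a component of
  \<open>real ^ 's\<close>. With \<open>W i k\<close> the derivatives of \<open>u i''\<close> at a
  point, the hypothesis says that the Wronskian does not vanish there.\<close>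

lemma square_system_solvable:
  fixes W :: "'s::finite \<Rightarrow> nat \<Rightarrow> real"
  assumes "\<And>a. (\<And>k. k < CARD('s) \<Longrightarrow> (\<Sum>i\<in>UNIV. a i * W i k) = 0) \<Longrightarrow> \<forall>i. a i = 0"
  obtains a where "\<And>k. k < CARD('s) \<Longrightarrow> (\<Sum>i\<in>UNIV. a i * W i k) = r k"
proof -
  obtain e :: "'s \<Rightarrow> nat" where e: "bij_betw e UNIV {..<CARD('s)}"
    by (rule bij_betw_UNIV_lessThan)
  define L :: "real ^ 's \<Rightarrow> real ^ 's" where "L = (\<lambda>x. \<chi> j. \<Sum>i\<in>UNIV. x $ i * W i (e j))"
  have lin: "linear L"
    by (rule linearI) (auto simp: L_def vec_eq_iff algebra_simps sum.distrib sum_distrib_left)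
  have ek: "\<exists>j. e j = k" if "k < CARD('s)" for k
    using e that by (metis bij_betw_imp_surj_on imageE lessThan_iff)
  have "inj L"
    unfolding linear_injective_0[OF lin]
  proof (intro allI impI)
    fix x assume "L x = 0"
    then have "(\<Sum>i\<in>UNIV. x $ i * W i k) = 0" if "k < CARD('s)" for k
      using ek[OF that] by (auto simp: L_def vec_eq_iff)
    then show "x = 0"
      using assms[of "\<lambda>i. x $ i"] by (simp add: vec_eq_iff)
  qed
  then have "surj L"
    using lin linear_injective_imp_surjective by blast
  then obtain x where x: "L x = (\<chi> j. r (e j))"
    by (metis surjD)
  show ?thesis
  proof (rule that[of "\<lambda>i. x $ i"])
    fix k assume "k < CARD('s)"
    then show "(\<Sum>i\<in>UNIV. x $ i * W i k) = r k"
      using ek[of k] x by (auto simp: L_def vec_eq_iff)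
  qed
qed

lemma poly_eq_sum_atMost:
  fixes p :: "'a::comm_semiring_1 poly"
  assumes "degree p \<le> n"
  shows "poly p x = (\<Sum>k\<le>n. coeff p k * x ^ k)"
  unfolding poly_altdef using assms
  by (intro sum.mono_neutral_left) (auto simp: coeff_eq_0)

text \<open>Weights act on polynomials through their moments
  \<open>\<beta> \<bullet> monomial_vec c k\<close>; the factor \<open>fact k\<close> undoes the
  scaling in \<open>monomial_vec\<close>.\<close>

lemma inner_monomial_poly:
  fixes c \<beta> :: "real ^ 's::finite"
  assumes "degree p \<le> n"
  shows "(\<Sum>i\<in>UNIV. \<beta> $ i * poly p (c $ i))
    = (\<Sum>k\<le>n. coeff p k * fact k * (\<beta> \<bullet> monomial_vec c k))"
proof -
  have "(\<Sum>i\<in>UNIV. \<beta> $ i * poly p (c $ i)) = (\<Sum>i\<in>UNIV. \<beta> $ i * (\<Sum>k\<le>n. coeff p k * (c $ i) ^ k))"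
    using poly_eq_sum_atMost[OF assms] by simp
  also have "\<dots> = (\<Sum>k\<le>n. \<Sum>i\<in>UNIV. \<beta> $ i * (coeff p k * (c $ i) ^ k))"
    unfolding sum_distrib_left by (rule sum.swap)
  also have "\<dots> = (\<Sum>k\<le>n. coeff p k * fact k * (\<beta> \<bullet> monomial_vec c k))"
    by (simp add: inner_vec_def monomial_vec_def sum_distrib_left algebra_simps)
  finally show ?thesis .
qed

text \<open>For distinct nodes the map from weights to their first \<open>CARD('s)\<close> moments
  is linear and injective, and in finite dimension such a map is bounded below.\<close>

lemma vandermonde_bound:
  fixes c :: "real ^ 's::finite"
  assumes "inj (\<lambda>i. c $ i)"
  obtains C where "C > 0" "\<And>\<beta>. norm \<beta> \<le> C * (\<Sum>k<CARD('s). \<bar>\<beta> \<bullet> monomial_vec c k\<bar>)"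
proof -
  obtain e :: "'s \<Rightarrow> nat" where e: "bij_betw e UNIV {..<CARD('s)}"
    by (rule bij_betw_UNIV_lessThan)
  define L :: "real ^ 's \<Rightarrow> real ^ 's" where "L = (\<lambda>x. \<chi> j. x \<bullet> monomial_vec c (e j))"
  have lin: "linear L"
    by (rule linearI) (auto simp: L_def vec_eq_iff inner_add_left)
  have ek: "\<exists>j. e j = k" if "k < CARD('s)" for k
    using e that by (metis bij_betw_imp_surj_on imageE lessThan_iff)
  have "inj L"
    unfolding linear_injective_0[OF lin]
  proof (intro allI impI)
    fix x assume "L x = 0"
    then have x: "x \<bullet> monomial_vec c k = 0" if "k < CARD('s)" for k
      using ek[OF that] by (auto simp: L_def vec_eq_iff)
    have "x $ i = 0" for i
    proof -
      \<comment> \<open>Up to a nonzero factor, \<open>p\<close> is the Lagrange basis polynomial of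
        node \<open>i\<close>. It isolates the component \<open>x $ i\<close>, and its degree is low
        enough that only the vanishing moments occur.\<close>
      define p where "p = (\<Prod>j\<in>UNIV - {i}. [:- c $ j, 1:])"
      have deg: "degree p \<le> CARD('s) - 1"
        unfolding p_def by (subst degree_prod_sum_eq) (auto simp: card_Diff_singleton)
      have pj: "poly p (c $ j) = 0" if "j \<noteq> i" for j
        using that by (auto simp: p_def poly_prod)
      have pi: "poly p (c $ i) \<noteq> 0"
        using assms by (auto simp: p_def poly_prod inj_def)
      have "x $ i * poly p (c $ i) = (\<Sum>j\<in>UNIV. x $ j * poly p (c $ j))"
        using pj by (subst sum.remove[of _ i]) auto
      also have "\<dots> = (\<Sum>k\<le>CARD('s) - 1. coeff p k * fact k * (x \<bullet> monomial_vec c k))"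
        by (rule inner_monomial_poly[OF deg])
      also have "\<dots> = 0"
      proof (rule sum.neutral, rule ballI)
        fix k assume "k \<in> {..CARD('s) - 1}"
        then have "k < CARD('s)" using zero_less_card_finite[where 'a='s] by (auto simp del: zero_less_card_finite)
        then show "coeff p k * fact k * (x \<bullet> monomial_vec c k) = 0" using x by simp
      qed
      finally show ?thesis using pi by simp
    qed
    then show "x = 0" by (simp add: vec_eq_iff)
  qed
  then obtain B where B: "B > 0" "\<And>x. B * norm x \<le> norm (L x)"
    using linear_inj_bounded_below_pos[OF lin] by blast
  have "norm x \<le> (1 / B) * (\<Sum>k<CARD('s). \<bar>x \<bullet> monomial_vec c k\<bar>)" for x
  proof -
    have "norm (L x) \<le> (\<Sum>j\<in>UNIV. \<bar>L x $ j\<bar>)"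
      by (rule norm_le_l1_cart)
    also have "\<dots> = (\<Sum>k<CARD('s). \<bar>x \<bullet> monomial_vec c k\<bar>)"
      unfolding L_def vec_lambda_beta by (rule sum.reindex_bij_betw[OF e])
    finally show ?thesis
      using B(1) B(2)[of x] by (simp add: field_simps)
  qed
  then show ?thesis
    using B(1) that[of "1 / B"] by simp
qed

section \<open>Boundedness and limiting moments of fitted weights\<close>

text \<open>Dividing the exactness relation for index \<open>k\<close> by \<open>h ^ k\<close>
  leaves the moment equation with limit \<open>\<mu> k\<close>, perturbed by O(h) times
  \<open>norm (\<beta> h) + 1\<close>. The Vandermonde bound turns this into an inequality for
  \<open>norm (\<beta> h)\<close> in terms of itself, and for small \<open>h\<close> the right-hand
  occurrence is absorbed. Boundedness then makes the perturbation O(h).\<close>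

lemma fitted_weights_asymptotics:
  fixes \<beta> :: "real \<Rightarrow> real ^ 's::finite"
  assumes inj: "inj (\<lambda>i. c $ i)" and F: "F \<le> at_right 0"
    and g: "\<And>k. k < CARD('s) \<Longrightarrow>
      (\<lambda>h. norm (g k h - h ^ k *\<^sub>R monomial_vec c k)) \<in> O[F](\<lambda>h. h ^ (k + 1))"
    and q: "\<And>k. k < CARD('s) \<Longrightarrow> (\<lambda>h. q k h - \<mu> k * h ^ k) \<in> O[F](\<lambda>h. h ^ (k + 1))"
    and eq: "\<And>k. k < CARD('s) \<Longrightarrow> eventually (\<lambda>h. \<beta> h \<bullet> g k h = q k h) F"
  shows "(\<lambda>h. norm (\<beta> h)) \<in> O[F](\<lambda>_. 1)"
    and "\<And>k. k < CARD('s) \<Longrightarrow> (\<lambda>h. \<beta> h \<bullet> monomial_vec c k - \<mu> k) \<in> O[F](\<lambda>h. h)"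
proof -
  have "\<forall>k\<in>{..<CARD('s)}. \<exists>C. C > 0 \<and> eventually (\<lambda>h. norm (g k h - h ^ k *\<^sub>R monomial_vec c k) \<le> C * \<bar>h ^ (k + 1)\<bar>) F"
  proof
    fix k assume "k \<in> {..<CARD('s)}"
    then have "k < CARD('s)" by simp
    from landau_o.bigE[OF g[OF this]] obtain C
      where "C > 0" "eventually (\<lambda>h. norm (norm (g k h - h ^ k *\<^sub>R monomial_vec c k)) \<le> C * norm (h ^ (k + 1))) F" .
    then show "\<exists>C. C > 0 \<and> eventually (\<lambda>h. norm (g k h - h ^ k *\<^sub>R monomial_vec c k) \<le> C * \<bar>h ^ (k + 1)\<bar>) F"
      unfolding real_norm_def abs_norm_cancel by blast
  qed
  from bchoice[OF this] obtain Cg where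
    Cg_pos: "\<And>k. k < CARD('s) \<Longrightarrow> Cg k > (0::real)" and
    Cg: "\<And>k. k < CARD('s) \<Longrightarrow> eventually (\<lambda>h. norm (g k h - h ^ k *\<^sub>R monomial_vec c k) \<le> Cg k * \<bar>h ^ (k + 1)\<bar>) F"
    by blast
  have "\<forall>k\<in>{..<CARD('s)}. \<exists>C. C > 0 \<and> eventually (\<lambda>h. \<bar>q k h - \<mu> k * h ^ k\<bar> \<le> C * \<bar>h ^ (k + 1)\<bar>) F"
  proof
    fix k assume "k \<in> {..<CARD('s)}"
    then have "k < CARD('s)" by simp
    from landau_o.bigE[OF q[OF this]] obtain C
      where "C > 0" "eventually (\<lambda>h. norm (q k h - \<mu> k * h ^ k) \<le> C * norm (h ^ (k + 1))) F" .
    then show "\<exists>C. C > 0 \<and> eventually (\<lambda>h. \<bar>q k h - \<mu> k * h ^ k\<bar> \<le> C * \<bar>h ^ (k + 1)\<bar>) F"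
      unfolding real_norm_def abs_norm_cancel by blast
  qed
  from bchoice[OF this] obtain Cq where
    Cq_pos: "\<And>k. k < CARD('s) \<Longrightarrow> Cq k > (0::real)" and
    Cq: "\<And>k. k < CARD('s) \<Longrightarrow> eventually (\<lambda>h. \<bar>q k h - \<mu> k * h ^ k\<bar> \<le> Cq k * \<bar>h ^ (k + 1)\<bar>) F"
    by blast
  have pos: "Cg k > 0 \<and> Cq k > 0" if "k < CARD('s)" for k
    using Cg_pos Cq_pos that by blast
  \<comment> \<open>One constant dominates the error constants for all \<open>k\<close>, so a single
    inequality \<open>dev\<close> covers every moment.\<close>
  define C where "C = (\<Sum>k<CARD('s). Cg k + Cq k)"
  have Ck: "Cg k + Cq k \<le> C" if "k < CARD('s)" for k
    unfolding C_def by (rule member_le_sum) (use that pos in \<open>auto simp: add_nonneg_nonneg less_imp_le\<close>)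
  have "C > 0"
    using Ck[of 0] pos[of 0] zero_less_card_finite[where 'a = 's] by linarith
  obtain V where V: "V > 0" "\<And>x. norm x \<le> V * (\<Sum>k<CARD('s). \<bar>x \<bullet> monomial_vec c k\<bar>)"
    using vandermonde_bound[OF inj] by metis
  have small: "eventually (\<lambda>h. 0 < h \<and> h < \<delta>) F" if "\<delta> > 0" for \<delta>
    using filter_leD[OF F eventually_at_right_real[OF that]] by simp
  have dev: "eventually (\<lambda>h. \<forall>k<CARD('s). \<bar>\<beta> h \<bullet> monomial_vec c k - \<mu> k\<bar> \<le> C * h * (norm (\<beta> h) + 1)) F"
  proof -
    have "eventually (\<lambda>h. \<forall>k\<in>{..<CARD('s)}. \<bar>\<beta> h \<bullet> monomial_vec c k - \<mu> k\<bar> \<le> C * h * (norm (\<beta> h) + 1)) F"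
    proof (rule eventually_ball_finite[OF finite_lessThan], rule ballI)
      fix k assume "k \<in> {..<CARD('s)}"
      then have k: "k < CARD('s)" by simp
      show "eventually (\<lambda>h. \<bar>\<beta> h \<bullet> monomial_vec c k - \<mu> k\<bar> \<le> C * h * (norm (\<beta> h) + 1)) F"
        using Cg[OF k] Cq[OF k] eq[OF k] small[OF zero_less_one]
      proof eventually_elim
        case (elim h)
        then have h: "h > 0" by simp
        let ?b = "\<beta> h" and ?m = "monomial_vec c k"
        have "h ^ k * (?b \<bullet> ?m - \<mu> k) = (q k h - \<mu> k * h ^ k) - ?b \<bullet> (g k h - h ^ k *\<^sub>R ?m)"
          using elim by (simp add: inner_diff_right algebra_simps)
        then have "h ^ k * \<bar>?b \<bullet> ?m - \<mu> k\<bar> = \<bar>(q k h - \<mu> k * h ^ k) - ?b \<bullet> (g k h - h ^ k *\<^sub>R ?m)\<bar>"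
          using h by (metis abs_mult abs_of_pos zero_less_power)
        also have "\<dots> \<le> Cq k * h ^ (k + 1) + norm ?b * (Cg k * h ^ (k + 1))"
        proof -
          have "\<bar>?b \<bullet> (g k h - h ^ k *\<^sub>R ?m)\<bar> \<le> norm ?b * norm (g k h - h ^ k *\<^sub>R ?m)"
            by (rule Cauchy_Schwarz_ineq2)
          also have "\<dots> \<le> norm ?b * (Cg k * h ^ (k + 1))"
            using elim h by (intro mult_left_mono) auto
          finally show ?thesis using elim h by simp
        qed
        also have "\<dots> = h ^ k * (h * (Cq k + norm ?b * Cg k))"
          by (simp add: algebra_simps)
        finally have "\<bar>?b \<bullet> ?m - \<mu> k\<bar> \<le> h * (Cq k + norm ?b * Cg k)"
          using h by simp
        also have "\<dots> \<le> h * (C * 1 + norm ?b * C)"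
          using Ck[OF k] pos[OF k] h by (intro mult_left_mono add_mono) auto
        finally show ?case by (simp add: algebra_simps)
      qed
    qed
    then show ?thesis by (simp add: Ball_def)
  qed
  define N where "N = real CARD('s)"
  have N: "N > 0" by (simp add: N_def)
  define M where "M = V * (\<Sum>k<CARD('s). \<bar>\<mu> k\<bar>)"
  \<comment> \<open>Below this threshold \<open>V * N * C * h\<close> is at most 1/2, so half of
    \<open>norm (\<beta> h)\<close> moves to the left-hand side; this gives the bound
    \<open>2 * M + 1\<close>.\<close>
  have "1 / (2 * V * N * C) > 0"
    using V(1) N \<open>C > 0\<close> by simp
  note small' = small[OF this]
  have bd: "eventually (\<lambda>h. norm (\<beta> h) \<le> 2 * M + 1) F"
    using dev small'
  proof eventually_elim
    case (elim h)
    have "norm (\<beta> h) \<le> V * (\<Sum>k<CARD('s). \<bar>\<beta> h \<bullet> monomial_vec c k\<bar>)"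
      by (rule V)
    also have "\<dots> \<le> V * (\<Sum>k<CARD('s). \<bar>\<mu> k\<bar> + C * h * (norm (\<beta> h) + 1))"
    proof (intro mult_left_mono sum_mono)
      fix k assume "k \<in> {..<CARD('s)}"
      then have "\<bar>\<beta> h \<bullet> monomial_vec c k - \<mu> k\<bar> \<le> C * h * (norm (\<beta> h) + 1)"
        using elim(1) by blast
      then show "\<bar>\<beta> h \<bullet> monomial_vec c k\<bar> \<le> \<bar>\<mu> k\<bar> + C * h * (norm (\<beta> h) + 1)"
        by linarith
    qed (use V(1) in simp)
    also have "\<dots> = M + V * N * C * h * (norm (\<beta> h) + 1)"
      by (simp add: M_def N_def sum.distrib algebra_simps)
    also have "\<dots> \<le> M + 1 / 2 * (norm (\<beta> h) + 1)"
    proof -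
      have "V * N * C * h \<le> 1 / 2"
        using elim(2) V(1) \<open>C > 0\<close> N by (simp add: field_simps)
      then show ?thesis
        by (intro add_left_mono mult_right_mono) auto
    qed
    finally show ?case by (simp add: field_simps)
  qed
  show "(\<lambda>h. norm (\<beta> h)) \<in> O[F](\<lambda>_. 1)"
    using bd by (intro bigoI[where c = "2 * M + 1"]) simp
  show "(\<lambda>h. \<beta> h \<bullet> monomial_vec c k - \<mu> k) \<in> O[F](\<lambda>h. h)" if "k < CARD('s)" for k
  proof (rule bigoI[where c = "C * (2 * M + 2)"])
    show "eventually (\<lambda>h. norm (\<beta> h \<bullet> monomial_vec c k - \<mu> k) \<le> C * (2 * M + 2) * norm h) F"
      using dev bd small[OF zero_less_one]
    proof eventually_elim
      case (elim h)
      then have "\<bar>\<beta> h \<bullet> monomial_vec c k - \<mu> k\<bar> \<le> C * h * (norm (\<beta> h) + 1)"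
        using that by blast
      also have "\<dots> \<le> C * h * (2 * M + 1 + 1)"
        using elim \<open>C > 0\<close> by (intro mult_left_mono) auto
      finally show ?case using elim by (simp add: algebra_simps)
    qed
  qed
qed

text \<open>This is the expansion of the second derivative taken at all nodes at once, the Euclidean
  norm being bounded by the sum of the components.\<close>

lemma at_nodes_flat_bigo:
  fixes c :: "real ^ 's::finite"
  assumes D: "jet_on (k + 3) {a..b} D" and flat: "\<And>j. j < k \<Longrightarrow> D (j + 2) t = 0"
    and t: "t \<in> {a..b}" and inI: "\<And>i. eventually (\<lambda>h. t + c $ i * h \<in> {a..b}) F"
  shows "(\<lambda>h. norm (at_nodes (D 2) c t h - (D (k + 2) t * h ^ k) *\<^sub>R monomial_vec c k))
    \<in> O[F](\<lambda>h. h ^ (k + 1))"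
proof -
  have comp: "(at_nodes (D 2) c t h - (D (k + 2) t * h ^ k) *\<^sub>R monomial_vec c k) $ i
      = D 2 (t + c $ i * h) - D (k + 2) t * (c $ i * h) ^ k / fact k" for h i
    by (simp add: at_nodes_def nodes_def monomial_vec_def power_mult_distrib)
  have "(\<lambda>h. \<Sum>i\<in>UNIV. norm (D 2 (t + c $ i * h) - D (k + 2) t * (c $ i * h) ^ k / fact k))
      \<in> O[F](\<lambda>h. h ^ (k + 1))"
    by (rule big_sum_in_bigo) (use jet_flat_bigo(3)[OF D flat t inI] in simp)
  moreover have "(\<lambda>h. norm (at_nodes (D 2) c t h - (D (k + 2) t * h ^ k) *\<^sub>R monomial_vec c k))
      \<in> O[F](\<lambda>h. \<Sum>i\<in>UNIV. norm (D 2 (t + c $ i * h) - D (k + 2) t * (c $ i * h) ^ k / fact k))"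
  proof (rule bigoI[where c = 1], rule always_eventually, rule allI)
    fix h
    show "norm (norm (at_nodes (D 2) c t h - (D (k + 2) t * h ^ k) *\<^sub>R monomial_vec c k))
      \<le> 1 * norm (\<Sum>i\<in>UNIV. norm (D 2 (t + c $ i * h) - D (k + 2) t * (c $ i * h) ^ k / fact k))"
      using norm_le_l1_cart[of "at_nodes (D 2) c t h - (D (k + 2) t * h ^ k) *\<^sub>R monomial_vec c k"]
      unfolding comp by simp
  qed
  ultimately show ?thesis
    by (rule landau_o.big_trans[rotated])
qed

section \<open>Order of a functional that is exact on the \<open>u i\<close>\<close>

lemma inner_bigo:
  fixes \<beta> v :: "'a \<Rightarrow> 'b::real_inner"
  assumes "(\<lambda>h. norm (\<beta> h)) \<in> O[F](\<lambda>_. 1 :: real)" and "(\<lambda>h. norm (v h)) \<in> O[F](g :: 'a \<Rightarrow> real)"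
  shows "(\<lambda>h. \<beta> h \<bullet> v h) \<in> O[F](g)"
proof -
  have "(\<lambda>h. norm (\<beta> h) * norm (v h)) \<in> O[F](\<lambda>h. 1 * g h)"
    by (intro landau_o.big.mult assms)
  then have "(\<lambda>h. norm (\<beta> h) * norm (v h)) \<in> O[F](g)" by simp
  moreover have "(\<lambda>h. \<beta> h \<bullet> v h) \<in> O[F](\<lambda>h. norm (\<beta> h) * norm (v h))"
    by (intro bigoI[where c = 1] always_eventually allI) (simp add: Cauchy_Schwarz_ineq2)
  ultimately show ?thesis by (rule landau_o.big_trans[rotated])
qed

lemma bigo_divide_power:
  fixes g :: "real \<Rightarrow> real"
  assumes "F \<le> at_right 0" "g \<in> O[F](\<lambda>h. h ^ (k + m))"
  shows "(\<lambda>h. g h / h ^ m) \<in> O[F](\<lambda>h. h ^ k)"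
proof -
  have ev: "eventually (\<lambda>h. h > 0) F"
    using filter_leD[OF assms(1) eventually_at_right_less] .
  have "(\<lambda>h. g h / h ^ m) \<in> O[F](\<lambda>h. h ^ (k + m) / h ^ m)"
    by (intro landau_o.big.divide_right assms(2) eventually_mono[OF ev]) simp
  also have "(\<lambda>h. h ^ (k + m) / h ^ m) \<in> O[F](\<lambda>h. h ^ k)"
    by (intro bigoI[where c = 1] eventually_mono[OF ev]) (simp add: power_add)
  finally show ?thesis .
qed

lemma id_bigo_1: "F \<le> at_right 0 \<Longrightarrow> (\<lambda>h::real. h) \<in> O[F](\<lambda>_. 1 :: real)"
  by (intro bigoI[where c = 1] eventually_mono[OF filter_leD[OF _ eventually_at_right_real[OF zero_less_one]]])
     auto

text \<open>
  The functional \<open>q\<close> stands for the exact increment, in terms of a function and its derivatives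
  \<open>D 0, D 1, \<dots>\<close>, that \<open>\<beta> h\<close> approximates; \<open>\<mu> k\<close> is the scaled value of \<open>q\<close> at a function whose second
  derivative is $(x-t)^k/k!$.
\<close>

lemma fitted_functional_order:
  fixes c :: "real ^ 's::finite" and \<beta> :: "real \<Rightarrow> real ^ 's"
    and U :: "'s \<Rightarrow> nat \<Rightarrow> real \<Rightarrow> real"
    and q :: "(nat \<Rightarrow> real \<Rightarrow> real) \<Rightarrow> real \<Rightarrow> real"
  assumes inj: "inj (\<lambda>i. c $ i)" and F: "F \<le> at_right 0"
    and t: "t \<in> {a..b}" and inI: "\<And>i. eventually (\<lambda>h. t + c $ i * h \<in> {a..b}) F"
    and U: "\<And>i. jet_on (CARD('s) + 3) {a..b} (U i)"
    and wronskian: "\<forall>a. (\<forall>k<CARD('s). (\<Sum>i\<in>UNIV. a i * U i (k + 2) t) = 0) \<longrightarrow> (\<forall>i. a i = 0)"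
    and expand: "\<forall>k D. jet_on (k + 3) {a..b} D \<longrightarrow> (\<forall>j<k. D (j + 2) t = 0) \<longrightarrow>
      (\<lambda>h. q D h - D (k + 2) t * \<mu> k * h ^ k) \<in> O[F](\<lambda>h. h ^ (k + 1))"
    and q_diff_sum: "\<And>D a h. q (\<lambda>j x. D j x - (\<Sum>i\<in>UNIV. a i * U i j x)) h
      = q D h - (\<Sum>i\<in>UNIV. a i * q (U i) h)"
    and q_zero: "\<And>h. q (\<lambda>_ _. 0) h = 0"
    and exact: "\<And>i. eventually (\<lambda>h. q (U i) h = \<beta> h \<bullet> at_nodes (U i 2) c t h) F"
  shows "(\<lambda>h. norm (\<beta> h)) \<in> O[F](\<lambda>_. 1)"
    and "\<And>D. jet_on (CARD('s) + 3) {a..b} D \<Longrightarrow>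
      (\<lambda>h. q D h - \<beta> h \<bullet> at_nodes (D 2) c t h) \<in> O[F](\<lambda>h. h ^ CARD('s))"
    and "\<And>D. jet_on (CARD('s) + 3) {a..b} D \<Longrightarrow>
      (\<Sum>k\<le>CARD('s). coeff (\<Prod>i\<in>UNIV. [:- c $ i, 1:]) k * fact k * \<mu> k) = 0 \<Longrightarrow>
      (\<lambda>h. q D h - \<beta> h \<bullet> at_nodes (D 2) c t h) \<in> O[F](\<lambda>h. h ^ (CARD('s) + 1))"
proof -
  define s where "s = CARD('s)"
  have expand: "(\<lambda>h. q D h - D (k + 2) t * \<mu> k * h ^ k) \<in> O[F](\<lambda>h. h ^ (k + 1))"
    if "jet_on (k + 3) {a..b} D" "\<And>j. j < k \<Longrightarrow> D (j + 2) t = 0" for k D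
    using expand that by blast
  have exact_all: "eventually (\<lambda>h. \<forall>i. q (U i) h = \<beta> h \<bullet> at_nodes (U i 2) c t h) F"
    by (intro eventually_all_finite exact)
  \<comment> \<open>The defect of \<open>\<beta>\<close> is linear and vanishes on every
    \<open>U i\<close>, so subtracting a combination of them leaves it unchanged.\<close>
  have residual: "eventually (\<lambda>h. q (\<lambda>j x. D j x - (\<Sum>i\<in>UNIV. \<alpha> i * U i j x)) h
        - \<beta> h \<bullet> at_nodes (\<lambda>x. D 2 x - (\<Sum>i\<in>UNIV. \<alpha> i * U i 2 x)) c t h
      = q D h - \<beta> h \<bullet> at_nodes (D 2) c t h) F" for D \<alpha>
    using exact_all
  proof eventually_elim
    case (elim h)
    have "at_nodes (\<lambda>x. D 2 x - (\<Sum>i\<in>UNIV. \<alpha> i * U i 2 x)) c t h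
        = at_nodes (D 2) c t h - (\<Sum>i\<in>UNIV. \<alpha> i *\<^sub>R at_nodes (U i 2) c t h)"
      by (simp add: at_nodes_def vec_eq_iff)
    then show ?case
      using elim by (simp add: q_diff_sum inner_diff_right inner_sum_right)
  qed
  \<comment> \<open>By the Wronskian condition, second derivatives of combinations of the
    \<open>u i\<close> attain any prescribed derivatives of order below \<open>s\<close> at
    \<open>t\<close>.\<close>
  have match: "\<exists>\<alpha>. \<forall>j<s. (\<Sum>i\<in>UNIV. \<alpha> i * U i (j + 2) t) = r j" for r
  proof -
    obtain \<alpha> where "\<And>j. j < CARD('s) \<Longrightarrow> (\<Sum>i\<in>UNIV. \<alpha> i * U i (j + 2) t) = r j"
      by (rule square_system_solvable[where W = "\<lambda>i k. U i (k + 2) t" and r = r])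
         (use wronskian in blast)+
    then show ?thesis by (auto simp: s_def)
  qed
  \<comment> \<open>The sign is negative because \<open>W k\<close> is formed as zero minus a
    combination; this way the facts about differences \<open>D j x - \<Sum>\<close> apply to it with
    \<open>D\<close> zero.\<close>
  have "\<forall>k. \<exists>\<alpha>. \<forall>j<s. (\<Sum>i\<in>UNIV. \<alpha> i * U i (j + 2) t) = (if j = k then -1 else 0)"
    by (rule allI, rule match)
  from choice[OF this] obtain \<alpha> where
    \<alpha>: "\<And>k j. j < s \<Longrightarrow> (\<Sum>i\<in>UNIV. \<alpha> k i * U i (j + 2) t) = (if j = k then -1 else 0)"
    by blast
  define W where "W k = (\<lambda>j x. 0 - (\<Sum>i\<in>UNIV. \<alpha> k i * U i j x))" for k :: nat
  have W_jet: "jet_on (k + 3) {a..b} (W k)" if "k < s" for k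
    unfolding W_def using that U
    by (intro jet_on_le[OF jet_on_diff_sum[OF jet_on_zero U]]) (auto simp: s_def)
  have W_val: "W k (j + 2) t = (if j = k then 1 else 0)" if "j < s" for j k
    using \<alpha>[OF that, of k] by (simp add: W_def)
  have weights: "(\<lambda>h. norm (\<beta> h)) \<in> O[F](\<lambda>_. 1)"
    "\<And>k. k < CARD('s) \<Longrightarrow> (\<lambda>h. \<beta> h \<bullet> monomial_vec c k - \<mu> k) \<in> O[F](\<lambda>h. h)"
  proof -
    have g: "(\<lambda>h. norm (at_nodes (W k 2) c t h - h ^ k *\<^sub>R monomial_vec c k)) \<in> O[F](\<lambda>h. h ^ (k + 1))"
      if "k < CARD('s)" for k
      using at_nodes_flat_bigo[OF W_jet _ t inI, of k] W_val that by (simp add: s_def)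
    have q: "(\<lambda>h. q (W k) h - \<mu> k * h ^ k) \<in> O[F](\<lambda>h. h ^ (k + 1))" if "k < CARD('s)" for k
      using expand[OF W_jet, of k] W_val that by (simp add: s_def)
    have eq: "eventually (\<lambda>h. \<beta> h \<bullet> at_nodes (W k 2) c t h = q (W k) h) F" for k
    proof -
      have [simp]: "at_nodes (\<lambda>_. 0) c t h = 0" for h
        by (simp add: at_nodes_def vec_eq_iff)
      show ?thesis
        using residual[of "\<lambda>_ _. 0" "\<alpha> k"]
        by eventually_elim (simp add: W_def q_zero)
    qed
    note fitted_weights_asymptotics[OF inj F g q eq]
    then show "(\<lambda>h. norm (\<beta> h)) \<in> O[F](\<lambda>_. 1)"
      "\<And>k. k < CARD('s) \<Longrightarrow> (\<lambda>h. \<beta> h \<bullet> monomial_vec c k - \<mu> k) \<in> O[F](\<lambda>h. h)"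
      by blast+
  qed
  show "(\<lambda>h. norm (\<beta> h)) \<in> O[F](\<lambda>_. 1)" by (rule weights)
  \<comment> \<open>Removing the combination that matches the first \<open>s\<close> derivatives of
    \<open>D 2\<close> leaves \<open>Z\<close>, and \<open>A\<close> is \<open>Z (s + 2) t\<close>.
    Both order claims now depend only on the error
    \<open>\<mu> s - \<beta> h \<bullet> monomial_vec c s\<close> of the next moment: boundedness
    gives \<open>h ^ s\<close>, and a bound O(h) gives one more power.\<close>
  have leading: "\<exists>A. (\<lambda>h. q D h - \<beta> h \<bullet> at_nodes (D 2) c t h
      - A * h ^ s * (\<mu> s - \<beta> h \<bullet> monomial_vec c s)) \<in> O[F](\<lambda>h. h ^ (s + 1))"
    if D: "jet_on (CARD('s) + 3) {a..b} D" for D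
  proof -
    obtain \<alpha> where \<alpha>: "\<And>j. j < s \<Longrightarrow> (\<Sum>i\<in>UNIV. \<alpha> i * U i (j + 2) t) = D (j + 2) t"
      using match[of "\<lambda>j. D (j + 2) t"] by blast
    define Z where "Z = (\<lambda>j x. D j x - (\<Sum>i\<in>UNIV. \<alpha> i * U i j x))"
    have Z: "jet_on (s + 3) {a..b} Z"
      unfolding Z_def s_def by (rule jet_on_diff_sum[OF D U])
    have flat: "Z (j + 2) t = 0" if "j < s" for j
      using \<alpha>[OF that] by (simp add: Z_def)
    have est: "(\<lambda>h. (q Z h - Z (s + 2) t * \<mu> s * h ^ s)
          - \<beta> h \<bullet> (at_nodes (Z 2) c t h - (Z (s + 2) t * h ^ s) *\<^sub>R monomial_vec c s))
        \<in> O[F](\<lambda>h. h ^ (s + 1))"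
      by (intro sum_in_bigo(2) expand[OF Z flat] inner_bigo[OF weights(1)]
            at_nodes_flat_bigo[OF Z flat t inI])
    have "eventually (\<lambda>h. (q Z h - Z (s + 2) t * \<mu> s * h ^ s)
          - \<beta> h \<bullet> (at_nodes (Z 2) c t h - (Z (s + 2) t * h ^ s) *\<^sub>R monomial_vec c s)
        = q D h - \<beta> h \<bullet> at_nodes (D 2) c t h
          - Z (s + 2) t * h ^ s * (\<mu> s - \<beta> h \<bullet> monomial_vec c s)) F"
      using residual[of D \<alpha>]
      by eventually_elim (simp add: Z_def inner_diff_right algebra_simps)
    from landau_o.big.in_cong[OF this] est show ?thesis by blast
  qed
  show "(\<lambda>h. q D h - \<beta> h \<bullet> at_nodes (D 2) c t h) \<in> O[F](\<lambda>h. h ^ CARD('s))"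
    if D: "jet_on (CARD('s) + 3) {a..b} D" for D
  proof -
    obtain A where A: "(\<lambda>h. q D h - \<beta> h \<bullet> at_nodes (D 2) c t h
      - A * h ^ s * (\<mu> s - \<beta> h \<bullet> monomial_vec c s)) \<in> O[F](\<lambda>h. h ^ (s + 1))"
      using leading[OF D] by blast
    have "(\<lambda>h. \<mu> s - \<beta> h \<bullet> monomial_vec c s) \<in> O[F](\<lambda>_. 1)"
      by (intro sum_in_bigo(2) inner_bigo[OF weights(1)]) auto
    then have 1: "(\<lambda>h. A * h ^ s * (\<mu> s - \<beta> h \<bullet> monomial_vec c s)) \<in> O[F](\<lambda>h. h ^ s * 1)"
      by (intro landau_o.big.mult) auto
    have "(\<lambda>h::real. h * h ^ s) \<in> O[F](\<lambda>h. 1 * h ^ s)"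
      by (intro landau_o.big.mult id_bigo_1 F) auto
    then have "(\<lambda>h::real. h ^ (s + 1)) \<in> O[F](\<lambda>h. h ^ s)" by simp
    then have 2: "(\<lambda>h. q D h - \<beta> h \<bullet> at_nodes (D 2) c t h
      - A * h ^ s * (\<mu> s - \<beta> h \<bullet> monomial_vec c s)) \<in> O[F](\<lambda>h. h ^ s)"
      by (rule landau_o.big_trans[OF A])
    show ?thesis
      using sum_in_bigo(1)[OF 2, OF 1[simplified]] by (simp add: s_def)
  qed
  show "(\<lambda>h. q D h - \<beta> h \<bullet> at_nodes (D 2) c t h) \<in> O[F](\<lambda>h. h ^ (CARD('s) + 1))"
    if D: "jet_on (CARD('s) + 3) {a..b} D"
      and quad: "(\<Sum>k\<le>CARD('s). coeff (\<Prod>i\<in>UNIV. [:- c $ i, 1:]) k * fact k * \<mu> k) = 0" for D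
  proof -
    obtain A where A: "(\<lambda>h. q D h - \<beta> h \<bullet> at_nodes (D 2) c t h
      - A * h ^ s * (\<mu> s - \<beta> h \<bullet> monomial_vec c s)) \<in> O[F](\<lambda>h. h ^ (s + 1))"
      using leading[OF D] by blast
    define p where "p = (\<Prod>i\<in>UNIV. [:- c $ i, 1:])"
    have deg: "degree p = s"
      unfolding p_def s_def by (subst degree_prod_sum_eq) auto
    have lead: "coeff p s = 1"
      using lead_coeff_prod[of "\<lambda>i. [:- c $ i, 1:]" UNIV] deg by (simp add: p_def)
    have root: "poly p (c $ i) = 0" for i
      by (auto simp: p_def poly_prod)
    \<comment> \<open>The node polynomial \<open>p\<close> is monic of degree \<open>s\<close> and
      vanishes at all nodes, so \<open>\<beta> h\<close> annihilates it, and by \<open>quad\<close>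
      so does the limiting functional. Hence the error of moment \<open>s\<close> is a combination
      of the errors of the lower moments, each of which is O(h).\<close>
    have "\<mu> s - \<beta> h \<bullet> monomial_vec c s
        = (\<Sum>k<s. coeff p k * fact k / fact s * (\<beta> h \<bullet> monomial_vec c k - \<mu> k))" for h
    proof -
      have "(\<Sum>k\<le>s. coeff p k * fact k * (\<beta> h \<bullet> monomial_vec c k - \<mu> k)) = 0"
        using inner_monomial_poly[of p s "\<beta> h" c] deg root quad
        by (simp add: right_diff_distrib sum_subtractf p_def[symmetric] s_def[symmetric])
      then have "fact s * (\<mu> s - \<beta> h \<bullet> monomial_vec c s)
          = (\<Sum>k<s. coeff p k * fact k * (\<beta> h \<bullet> monomial_vec c k - \<mu> k))"
        by (simp add: lessThan_Suc_atMost[symmetric] lead algebra_simps)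
      then show ?thesis
        by (simp add: sum_divide_distrib[symmetric] field_simps)
    qed
    then have "(\<lambda>h. \<mu> s - \<beta> h \<bullet> monomial_vec c s) \<in> O[F](\<lambda>h. h)"
      using weights(2) by (simp only:) (intro big_sum_in_bigo, simp add: s_def)
    then have "(\<lambda>h. A * h ^ s * (\<mu> s - \<beta> h \<bullet> monomial_vec c s)) \<in> O[F](\<lambda>h. h ^ s * h)"
      by (intro landau_o.big.mult) auto
    then have 1: "(\<lambda>h. A * h ^ s * (\<mu> s - \<beta> h \<bullet> monomial_vec c s)) \<in> O[F](\<lambda>h. h ^ (s + 1))"
      by (simp add: mult.commute)
    show ?thesis
      using sum_in_bigo(1)[OF A 1] by (simp add: s_def)
  qed
qed

section \<open>Expansion of the increments approximated by \<open>b\<close>, \<open>d\<close> and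
  the rows of \<open>A\<close>\<close>

text \<open>The constants are the increments of \<tau>^(k+2)/(k+2)!, whose second derivative is
  \<tau>^k/k!, for unit step size. The division by \<open>h ^ 2\<close> or \<open>h\<close> leaves a
  leading term of order \<open>h ^ k\<close> in all three cases.\<close>

lemma jet_stage_bigo:
  fixes a b \<gamma> :: real
  assumes F: "F \<le> at_right 0" and t: "t \<in> {a..b}"
    and D: "jet_on (k + 3) {a..b} D" and flat: "\<And>j. j < k \<Longrightarrow> D (j + 2) t = 0"
    and in1: "eventually (\<lambda>h. t + h \<in> {a..b}) F"
    and in2: "eventually (\<lambda>h. t + h + \<gamma> * h \<in> {a..b}) F"
  shows "(\<lambda>h. (D 0 (t + h) - D 0 t - h * D 1 t) / h ^ 2 - D (k + 2) t * (1 / fact (k + 2)) * h ^ k)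
      \<in> O[F](\<lambda>h. h ^ (k + 1))"
    and "(\<lambda>h. (D 1 (t + h) - D 1 t) / h - D (k + 2) t * (1 / fact (k + 1)) * h ^ k)
      \<in> O[F](\<lambda>h. h ^ (k + 1))"
    and "(\<lambda>h. (D 0 (t + h + \<gamma> * h) - D 0 (t + h) - h * \<gamma> * D 1 (t + h)) / h ^ 2
        - D (k + 2) t * ((1 + \<gamma>) ^ (k + 2) / fact (k + 2) - 1 / fact (k + 2) - \<gamma> / fact (k + 1)) * h ^ k)
      \<in> O[F](\<lambda>h. h ^ (k + 1))"
proof -
  have pos: "eventually (\<lambda>h. h > 0) F"
    using filter_leD[OF F eventually_at_right_less] .
  have in1': "eventually (\<lambda>h. t + 1 * h \<in> {a..b}) F"
    using in1 by simp
  have in2': "eventually (\<lambda>h. t + (1 + \<gamma>) * h \<in> {a..b}) F"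
    using in2 by (simp add: algebra_simps)
  note A = jet_flat_bigo[OF D flat t in1'] and B = jet_flat_bigo[OF D flat t in2']
  have cong: "g \<in> O[F](\<lambda>h. h ^ (k + 1))"
    if "f \<in> O[F](\<lambda>h. h ^ (k + 1 + m))" "\<And>h. h > 0 \<Longrightarrow> f h / h ^ m = g h" for f g :: "real \<Rightarrow> real" and m
  proof -
    have "eventually (\<lambda>h. f h / h ^ m = g h) F"
      by (intro eventually_mono[OF pos] that(2))
    from landau_o.big.in_cong[OF this] bigo_divide_power[OF F that(1)] show ?thesis by blast
  qed
  show "(\<lambda>h. (D 0 (t + h) - D 0 t - h * D 1 t) / h ^ 2 - D (k + 2) t * (1 / fact (k + 2)) * h ^ k)
      \<in> O[F](\<lambda>h. h ^ (k + 1))"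
    by (rule cong[where m = 2, of "\<lambda>h. D 0 (t + 1 * h) - D 0 t - D 1 t * (1 * h)
            - D (k + 2) t * (1 * h) ^ (k + 2) / fact (k + 2)"])
       (use A(1) in \<open>simp add: numeral_3_eq_3\<close>, simp add: diff_divide_distrib power_add power2_eq_square mult.commute del: fact_Suc)
  show "(\<lambda>h. (D 1 (t + h) - D 1 t) / h - D (k + 2) t * (1 / fact (k + 1)) * h ^ k)
      \<in> O[F](\<lambda>h. h ^ (k + 1))"
    by (rule cong[where m = 1, of "\<lambda>h. D 1 (t + 1 * h) - D 1 t
            - D (k + 2) t * (1 * h) ^ (k + 1) / fact (k + 1)"])
       (use A(2) in \<open>simp add: numeral_2_eq_2\<close>, simp add: diff_divide_distrib del: fact_Suc)
  \<comment> \<open>The stage increment is the expansion of \<open>D 0\<close> at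
    \<open>(1 + \<gamma>) * h\<close>, minus that at \<open>h\<close>, minus
    \<open>\<gamma> * h\<close> times the expansion of \<open>D 1\<close> at \<open>h\<close>. The
    terms with \<open>D 0 t\<close> and \<open>D 1 t\<close> cancel.\<close>
  have "(\<lambda>h. D 0 (t + (1 + \<gamma>) * h) - D 0 t - D 1 t * ((1 + \<gamma>) * h)
            - D (k + 2) t * ((1 + \<gamma>) * h) ^ (k + 2) / fact (k + 2)
        - (D 0 (t + 1 * h) - D 0 t - D 1 t * (1 * h)
            - D (k + 2) t * (1 * h) ^ (k + 2) / fact (k + 2))
        - \<gamma> * h * (D 1 (t + 1 * h) - D 1 t
            - D (k + 2) t * (1 * h) ^ (k + 1) / fact (k + 1))) \<in> O[F](\<lambda>h. h ^ (k + 3))" (is "?f \<in> _")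
  proof (rule sum_in_bigo(2)[OF sum_in_bigo(2)[OF B(1) A(1)]])
    have "(\<lambda>h. \<gamma> * h * (D 1 (t + 1 * h) - D 1 t
            - D (k + 2) t * (1 * h) ^ (k + 1) / fact (k + 1))) \<in> O[F](\<lambda>h. h * h ^ (k + 2))"
      by (intro landau_o.big.mult A(2)) simp
    then show "(\<lambda>h. \<gamma> * h * (D 1 (t + 1 * h) - D 1 t
            - D (k + 2) t * (1 * h) ^ (k + 1) / fact (k + 1))) \<in> O[F](\<lambda>h. h ^ (k + 3))"
      by (simp add: numeral_3_eq_3)
  qed
  then have f: "?f \<in> O[F](\<lambda>h. h ^ (k + 1 + 2))"
    by (simp add: numeral_3_eq_3)
  show "(\<lambda>h. (D 0 (t + h + \<gamma> * h) - D 0 (t + h) - h * \<gamma> * D 1 (t + h)) / h ^ 2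
        - D (k + 2) t * ((1 + \<gamma>) ^ (k + 2) / fact (k + 2) - 1 / fact (k + 2) - \<gamma> / fact (k + 1)) * h ^ k)
      \<in> O[F](\<lambda>h. h ^ (k + 1))"
  proof (rule cong[OF f])
    fix h :: real assume h: "h > 0"
    have arg: "t + (1 + \<gamma>) * h = t + h + \<gamma> * h" by (simp add: algebra_simps)
    \<comment> \<open>Naming the power and the reciprocal factorials keeps them opaque to the ring
      simplification.\<close>
    define P where "P = (1 + \<gamma>) ^ (k + 2)"
    define X Y where "X = 1 / (fact (k + 2) :: real)" and "Y = 1 / (fact (k + 1) :: real)"
    have fh: "?f h = (D 0 (t + h + \<gamma> * h) - D 0 (t + h) - h * \<gamma> * D 1 (t + h))
        - D (k + 2) t * (P * X - X - \<gamma> * Y) * h ^ k * h ^ 2"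
      unfolding arg power_mult_distrib P_def[symmetric] divide_inverse X_def Y_def
      by (simp add: algebra_simps power_add power2_eq_square del: fact_Suc)
    show "?f h / h ^ 2 = (D 0 (t + h + \<gamma> * h) - D 0 (t + h) - h * \<gamma> * D 1 (t + h)) / h ^ 2
        - D (k + 2) t * ((1 + \<gamma>) ^ (k + 2) / fact (k + 2) - 1 / fact (k + 2) - \<gamma> / fact (k + 1)) * h ^ k"
      unfolding fh using h by (simp add: diff_divide_distrib P_def X_def Y_def del: fact_Suc)
  qed
qed

section \<open>Quadrature, perturbed stages and derivatives of the exact solution\<close>

lemma integral_poly_01:
  fixes p :: "real poly"
  assumes "degree p \<le> n"
  shows "integral {0..1} (poly p) = (\<Sum>k\<le>n. coeff p k / real (k + 1))"
proof -
  have mono: "((\<lambda>x::real. coeff p k * x ^ k) has_integral coeff p k / real (k + 1)) {0..1}" for k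
  proof -
    let ?G = "\<lambda>x::real. coeff p k / real (Suc k) * x ^ Suc k"
    have "(?G has_real_derivative coeff p k * x ^ k) (at x)" for x
      using DERIV_cmult[OF DERIV_pow[of "Suc k"], of "coeff p k / real (Suc k)" x]
      by (simp del: power_Suc of_nat_Suc)
    then have "((\<lambda>x::real. coeff p k * x ^ k) has_integral ?G 1 - ?G 0) {0..1}"
      by (intro fundamental_theorem_of_calculus)
         (auto simp: has_real_derivative_iff_has_vector_derivative[symmetric]
           intro: has_field_derivative_at_within)
    then show ?thesis by simp
  qed
  note poly_eq_sum_atMost[OF assms]
  then have "(poly p has_integral (\<Sum>k\<le>n. coeff p k / real (k + 1))) {0..1}"
    using has_integral_sum[of "{..n}", OF _ mono] by (simp add: fun_eq_iff cong: has_integral_cong)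
  then show ?thesis by (rule integral_unique)
qed

text \<open>The first form keeps the factor \<open>h ^ m\<close> and serves the defects of the
  weights; the second discards it, as \<open>h\<close> is bounded near 0, and serves the stage
  perturbation, whose order suffices by itself.\<close>

lemma power_mult_bigo:
  fixes g :: "real \<Rightarrow> real"
  assumes F: "F \<le> at_right 0" and g: "g \<in> O[F](\<lambda>h. h ^ k)"
  shows "(\<lambda>h. h ^ m * g h) \<in> O[F](\<lambda>h. h ^ (m + k))"
    and "(\<lambda>h. h ^ m * g h) \<in> O[F](\<lambda>h. h ^ k)"
proof -
  show "(\<lambda>h. h ^ m * g h) \<in> O[F](\<lambda>h. h ^ (m + k))"
    unfolding power_add by (intro landau_o.big.mult g) simp
  have "(\<lambda>h::real. h ^ m) \<in> O[F](\<lambda>_. 1)"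
    using landau_o.big_power[OF id_bigo_1[OF F], of m] by simp
  then have "(\<lambda>h. h ^ m * g h) \<in> O[F](\<lambda>h. 1 * h ^ k)"
    by (intro landau_o.big.mult g)
  then show "(\<lambda>h. h ^ m * g h) \<in> O[F](\<lambda>h. h ^ k)" by simp
qed

lemma norm_vec_bigo:
  fixes v :: "'a \<Rightarrow> real ^ 's::finite" and g :: "'a \<Rightarrow> real"
  assumes "\<And>i. (\<lambda>h. v h $ i) \<in> O[F](g)"
  shows "(\<lambda>h. norm (v h)) \<in> O[F](g)"
proof -
  have "(\<lambda>h. \<Sum>i\<in>UNIV. \<bar>v h $ i\<bar>) \<in> O[F](g)"
    using assms by (intro big_sum_in_bigo) (simp add: landau_o.big.abs_in_iff)
  moreover have "(\<lambda>h. norm (v h)) \<in> O[F](\<lambda>h. \<Sum>i\<in>UNIV. \<bar>v h $ i\<bar>)"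
    by (intro bigoI[where c = 1] always_eventually allI) (use norm_le_l1_cart in auto)
  ultimately show ?thesis by (rule landau_o.big_trans[rotated])
qed

text \<open>The nodes move with \<open>h\<close>, so the Lipschitz constant has to be uniform in
  time for a single constant to bound each component.\<close>

lemma f_at_nodes_lipschitz_bigo:
  fixes c :: "real ^ 's::finite" and Y Z :: "real \<Rightarrow> real ^ 's" and g :: "real \<Rightarrow> real"
  assumes lip: "\<And>x. x \<in> X \<Longrightarrow> L-lipschitz_on UNIV (f x)"
    and inX: "eventually (\<lambda>h. \<forall>i. nodes c t h $ i \<in> X) F"
    and Y: "(\<lambda>h. norm (Z h - Y h)) \<in> O[F](g)"
  shows "(\<lambda>h. norm (f_at_nodes f c t h (Z h) - f_at_nodes f c t h (Y h))) \<in> O[F](g)"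
proof (rule norm_vec_bigo)
  fix i
  have "(\<lambda>h. (f_at_nodes f c t h (Z h) - f_at_nodes f c t h (Y h)) $ i) \<in> O[F](\<lambda>h. norm (Z h - Y h))"
  proof (rule bigoI[where c = L], rule eventually_mono[OF inX])
    fix h assume "\<forall>i. nodes c t h $ i \<in> X"
    then have L: "L-lipschitz_on UNIV (f (nodes c t h $ i))"
      using lip by blast
    have "norm ((f_at_nodes f c t h (Z h) - f_at_nodes f c t h (Y h)) $ i) \<le> L * \<bar>(Z h - Y h) $ i\<bar>"
      using lipschitz_onD[OF L, of "Z h $ i" "Y h $ i"] by (simp add: f_at_nodes_def dist_real_def)
    also have "\<dots> \<le> L * norm (Z h - Y h)"
      by (intro mult_left_mono component_le_norm_cart lipschitz_on_nonneg[OF L])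
    finally show "norm ((f_at_nodes f c t h (Z h) - f_at_nodes f c t h (Y h)) $ i) \<le> L * norm (norm (Z h - Y h))"
      by simp
  qed
  then show "(\<lambda>h. (f_at_nodes f c t h (Z h) - f_at_nodes f c t h (Y h)) $ i) \<in> O[F](g)"
    using Y by (rule landau_o.big_trans)
qed

text \<open>Derivatives within a nondegenerate interval are unique, so the sequence supplied by
  smoothness agrees with \<open>y'\<close> and with the right-hand side along the solution. Thus
  \<open>f\<close> at exact stage values becomes the second derivative of \<open>y\<close>.\<close>

lemma ivp_solution_jet:
  assumes "0 < T" and sol: "ivp_solution t0 T f y0 y0' y y'"
    and "C_k_on (n + 2) {t0..t0+T} y"
  obtains D where "jet_on (n + 2) {t0..t0+T} D"
    and "\<And>x. x \<in> {t0..t0+T} \<Longrightarrow> D 0 x = y x"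
    and "\<And>x. x \<in> {t0..t0+T} \<Longrightarrow> D 1 x = y' x"
    and "\<And>x. x \<in> {t0..t0+T} \<Longrightarrow> D 2 x = f x (y x)"
proof -
  let ?I = "{t0..t0+T}"
  obtain D where D0: "\<And>x. x \<in> ?I \<Longrightarrow> D 0 x = y x" and D: "jet_on (n + 2) ?I D"
    using assms(3) C_k_on_iff_jet_on by blast
  have unique: "d = e" if "(g has_real_derivative d) (at x within ?I)"
    "(g has_real_derivative e) (at x within ?I)" "x \<in> ?I" for g d e x
    using vector_derivative_unique_within_closed_interval[of t0 "t0 + T" x g d e] that \<open>0 < T\<close>
    by (simp add: has_real_derivative_iff_has_vector_derivative)
  have step: "D (Suc j) x = g' x"
    if j: "j < n + 2" and g: "\<And>x. x \<in> ?I \<Longrightarrow> D j x = g x"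
      and g': "\<And>x. x \<in> ?I \<Longrightarrow> (g has_real_derivative g' x) (at x within ?I)" and x: "x \<in> ?I"
    for j g g' x
  proof (rule unique[OF _ _ x])
    show "(D j has_real_derivative D (Suc j) x) (at x within ?I)"
      using D j x unfolding jet_on_def by blast
    show "(D j has_real_derivative g' x) (at x within ?I)"
      by (rule has_field_derivative_transform_within[OF g'[OF x] zero_less_one x]) (use g in simp)
  qed
  have D1: "D 1 x = y' x" if "x \<in> ?I" for x
    using step[of 0 y y' x] D0 sol that unfolding ivp_solution_def by simp
  have D2: "D 2 x = f x (y x)" if "x \<in> ?I" for x
    using step[of 1 y' "\<lambda>x. f x (y x)" x] D1 sol that unfolding ivp_solution_def
    by (simp add: numeral_2_eq_2)
  show ?thesis
    by (rule that[OF D D0 D1 D2])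
qed

text \<open>Since \<open>fact k / fact (k + 1)\<close> is the integral of \<xi>^k over the unit
  interval, the sum is the integral of the node polynomial. It has the form needed for the
  functional of \<open>d\<close>, where \<open>\<mu> k\<close> is
  \<open>1 / fact (k + 1)\<close>.\<close>

lemma superconvergence_condition:
  fixes c :: "real ^ 's::finite"
  assumes "integral {0..1} (\<lambda>\<xi>::real. \<Prod>i\<in>UNIV. (\<xi> - c $ i)) = 0"
  shows "(\<Sum>k\<le>CARD('s). coeff (\<Prod>i\<in>UNIV. [:- c $ i, 1:]) k * fact k * (1 / fact (k + 1))) = 0"
proof -
  let ?p = "\<Prod>i\<in>UNIV. [:- c $ i, 1:]"
  have "degree ?p \<le> CARD('s)"
    by (subst degree_prod_sum_eq) auto
  from integral_poly_01[OF this]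
  have "(\<Sum>k\<le>CARD('s). coeff ?p k / real (k + 1)) = integral {0..1} (poly ?p)" by simp
  also have "poly ?p = (\<lambda>\<xi>. \<Prod>i\<in>UNIV. (\<xi> - c $ i))"
    by (simp add: fun_eq_iff poly_prod)
  finally have "(\<Sum>k\<le>CARD('s). coeff ?p k / real (k + 1)) = 0"
    using assms by simp
  moreover have "fact k * (1 / fact (k + 1)) = 1 / real (k + 1)" for k
    by simp
  then have "coeff ?p k * fact k * (1 / fact (k + 1)) = coeff ?p k / real (k + 1)" for k
    unfolding mult.assoc by (simp only: times_divide_eq_right mult_1_right)
  ultimately show ?thesis by simp
qed

section \<open>Local errors of one step\<close>

theorem theorem4p2:
  fixes t0 T y0 y0' :: real
    and f :: "real \<Rightarrow> real \<Rightarrow> real"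
    and y y' :: "real \<Rightarrow> real"
    and c :: "real ^ 's::finite"
    and u :: "'s \<Rightarrow> real \<Rightarrow> real"
    and S :: "real set"
    and A :: "real \<Rightarrow> real \<Rightarrow> real ^ 's ^ 's"
    and b d :: "real \<Rightarrow> real \<Rightarrow> real ^ 's"
    and tn :: real
  assumes "0 < T"
    and "ivp_rhs t0 T f"
    and "ivp_solution t0 T f y0 y0' y y'"
    and "C_k_on (CARD('s) + 3) {t0..t0+T} y"
    and "inj (\<lambda>i. c $ i)"
    and "open S" and "{t0..t0+T} \<subseteq> S"
    and "\<And>i. C_k_on (CARD('s) + 3) S (u i)"
    and "collocation_condition t0 T c u"
    and "fitted_method t0 T u c A b d"
    and "integral {0..1} (\<lambda>\<xi>::real. \<Prod>i\<in>UNIV. (\<xi> - c $ i)) = 0"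
    and "tn \<in> {t0..<t0+T}"
    and "wronskian_nonzero_at u tn"
  shows "has_orders_at t0 T u c A b d f y y' tn (CARD('s) + 1) (CARD('s) + 1)"
proof -
  define H where "H = at 0 within admissible_steps t0 T u c tn"
  define U where "U i j = (deriv ^^ j) (u i)" for i j
  have t: "tn \<in> {t0..t0+T}" using assms(12) by simp
  have H_le: "H \<le> at_right 0"
    unfolding H_def by (rule at_le) (auto simp: admissible_steps_def)
  have adm: "eventually (\<lambda>h. h \<in> admissible_steps t0 T u c tn) H"
    by (simp add: H_def eventually_at_filter)
  have inI: "eventually (\<lambda>h. tn + c $ i * h \<in> {t0..t0+T}) H" for i
    using adm by eventually_elim (auto simp: admissible_steps_def nodes_def)
  have inI1: "eventually (\<lambda>h. tn + h \<in> {t0..t0+T}) H"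
    using adm by eventually_elim (auto simp: admissible_steps_def)
  have inI2: "eventually (\<lambda>h. tn + h + c $ i * h \<in> {t0..t0+T}) H" for i
    using adm by eventually_elim (auto simp: admissible_steps_def nodes_def)
  have nodes_in: "eventually (\<lambda>h. \<forall>i. nodes c tn h $ i \<in> {t0..t0+T}) H"
    using adm by eventually_elim (auto simp: admissible_steps_def)
  have pos: "eventually (\<lambda>h. h > 0) H"
    using adm by eventually_elim (auto simp: admissible_steps_def)
  have U: "jet_on (CARD('s) + 3) {t0..t0+T} (U i)" for i
    unfolding U_def using jet_on_subset[OF C_k_on_open_jet] assms(6-8) by blast
  have wronskian: "\<forall>a. (\<forall>k<CARD('s). (\<Sum>i\<in>UNIV. a i * U i (k + 2) tn) = 0) \<longrightarrow> (\<forall>i. a i = 0)"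
    using assms(13) unfolding wronskian_nonzero_at_def U_def .
  obtain D where D: "jet_on (CARD('s) + 3) {t0..t0+T} D"
    and D_y: "\<And>x. x \<in> {t0..t0+T} \<Longrightarrow> D 0 x = y x" "\<And>x. x \<in> {t0..t0+T} \<Longrightarrow> D 1 x = y' x"
      "\<And>x. x \<in> {t0..t0+T} \<Longrightarrow> D 2 x = f x (y x)"
    by (rule ivp_solution_jet[OF assms(1) assms(3), of "CARD('s) + 1"])
       (use assms(4) in \<open>auto simp: numeral_3_eq_3\<close>)
  have coeffs: "eventually (\<lambda>h. fitted_coeffs u c tn h (A tn h) (b tn h) (d tn h)) H"
    using adm by eventually_elim
      (use assms(10,12) in \<open>auto simp: admissible_steps_def fitted_method_def\<close>)
  have U012: "U i 0 = u i" "U i 1 = deriv (u i)" "U i 2 = deriv (deriv (u i))" for i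
    by (simp_all add: U_def numeral_2_eq_2)
  note fitted = fitted_functional_order[where U = U, OF assms(5) H_le t inI U wronskian]
  \<comment> \<open>These are the three fitting equations solved for the inner product with the
    second derivatives, so the same order result applies to \<open>b\<close>, to \<open>d\<close>
    and to each row of \<open>A\<close>.\<close>
  define qb where "qb D h = (D 0 (tn + h) - D 0 tn - h * D 1 tn) / h ^ 2" for D :: "nat \<Rightarrow> real \<Rightarrow> real" and h
  define qd where "qd D h = (D 1 (tn + h) - D 1 tn) / h" for D :: "nat \<Rightarrow> real \<Rightarrow> real" and h
  define qA where "qA i D h = (D 0 (tn + h + c $ i * h) - D 0 (tn + h) - h * c $ i * D 1 (tn + h)) / h ^ 2"
    for i and D :: "nat \<Rightarrow> real \<Rightarrow> real" and h
  have exact_b: "eventually (\<lambda>h. qb (U i) h = b tn h \<bullet> at_nodes (U i 2) c tn h) H" for i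
    using coeffs pos unfolding qb_def U012 fitted_coeffs_def
    by eventually_elim (simp add: field_simps)
  have exact_d: "eventually (\<lambda>h. qd (U i) h = d tn h \<bullet> at_nodes (U i 2) c tn h) H" for i
    using coeffs pos unfolding qd_def U012 fitted_coeffs_def
    by eventually_elim (simp add: field_simps)
  have exact_A: "eventually (\<lambda>h. qA j (U i) h = row j (A tn h) \<bullet> at_nodes (U i 2) c tn h) H" for i j
    using coeffs pos
  proof eventually_elim
    case (elim h)
    then have "at_nodes (u i) c (tn + h) h $ j = (vec (u i (tn + h)) + (h * deriv (u i) (tn + h)) *\<^sub>R c
        + h^2 *\<^sub>R (A tn h *v at_nodes (deriv (deriv (u i))) c tn h)) $ j"
      unfolding fitted_coeffs_def by simp
    then have "u i (tn + h + c $ j * h) = u i (tn + h) + h * deriv (u i) (tn + h) * c $ j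
        + h^2 * (row j (A tn h) \<bullet> at_nodes (deriv (deriv (u i))) c tn h)"
      by (simp add: at_nodes_def nodes_def matrix_vector_mul_component row_def)
    then show ?case
      using elim(2) unfolding qA_def U012 by (simp add: field_simps)
  qed
  note lin_simps = right_diff_distrib diff_divide_distrib sum_subtractf sum_distrib_left sum_divide_distrib ac_simps
  have lin_b: "qb (\<lambda>j x. E j x - (\<Sum>i\<in>UNIV. a i * U i j x)) h = qb E h - (\<Sum>i\<in>UNIV. a i * qb (U i) h)"
    for E a h unfolding qb_def by (simp add: lin_simps)
  have lin_d: "qd (\<lambda>j x. E j x - (\<Sum>i\<in>UNIV. a i * U i j x)) h = qd E h - (\<Sum>i\<in>UNIV. a i * qd (U i) h)"
    for E a h unfolding qd_def by (simp add: lin_simps)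
  have lin_A: "qA k (\<lambda>j x. E j x - (\<Sum>i\<in>UNIV. a i * U i j x)) h = qA k E h - (\<Sum>i\<in>UNIV. a i * qA k (U i) h)"
    for k E a h unfolding qA_def by (simp add: lin_simps)
  have zero: "qb (\<lambda>_ _. 0) h = 0" "qd (\<lambda>_ _. 0) h = 0" "qA k (\<lambda>_ _. 0) h = 0" for h k
    by (simp_all add: qb_def qd_def qA_def)
  note stage = jet_stage_bigo[OF H_le t _ _ inI1 inI2]
  have expand_b: "\<forall>k D. jet_on (k + 3) {t0..t0+T} D \<longrightarrow> (\<forall>j<k. D (j + 2) tn = 0) \<longrightarrow>
      (\<lambda>h. qb D h - D (k + 2) tn * (1 / fact (k + 2)) * h ^ k) \<in> O[H](\<lambda>h. h ^ (k + 1))"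
    unfolding qb_def using stage(1) by blast
  have expand_d: "\<forall>k D. jet_on (k + 3) {t0..t0+T} D \<longrightarrow> (\<forall>j<k. D (j + 2) tn = 0) \<longrightarrow>
      (\<lambda>h. qd D h - D (k + 2) tn * (1 / fact (k + 1)) * h ^ k) \<in> O[H](\<lambda>h. h ^ (k + 1))"
    unfolding qd_def using stage(2) by blast
  have expand_A: "\<forall>k D. jet_on (k + 3) {t0..t0+T} D \<longrightarrow> (\<forall>j<k. D (j + 2) tn = 0) \<longrightarrow>
      (\<lambda>h. qA i D h - D (k + 2) tn * ((1 + c $ i) ^ (k + 2) / fact (k + 2) - 1 / fact (k + 2)
        - c $ i / fact (k + 1)) * h ^ k) \<in> O[H](\<lambda>h. h ^ (k + 1))" for i
    unfolding qA_def using stage(3) by blast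
  note fit_b = fitted[OF expand_b lin_b zero(1) exact_b]
  note fit_d = fitted[OF expand_d lin_d zero(2) exact_d]
  note fit_A = fitted[OF expand_A lin_A zero(3) exact_A]
  have main: "(\<lambda>h. y (tn + h) - step_y f c (b tn h) tn h (y tn) (y' tn) (Y h)) \<in> O[H](\<lambda>h. h ^ (CARD('s) + 1 + 1)) \<and>
         (\<lambda>h. y' (tn + h) - step_y' f c (d tn h) tn h (y' tn) (Y h)) \<in> O[H](\<lambda>h. h ^ (CARD('s) + 1 + 1)) \<and>
         (\<lambda>h. norm (at_nodes y c (tn + h) h
                - step_Y f c (A tn h) (b tn h) (d tn h) tn h (y tn) (y' tn) (Y h)))
            \<in> O[H](\<lambda>h. h ^ (CARD('s) + 1 + 1))"
    if Y: "(\<lambda>h. norm (at_nodes y c tn h - Y h)) \<in> O[H](\<lambda>h. h ^ (CARD('s) + 1 + 1))" for Y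
  proof (intro conjI)
    \<comment> \<open>The error of the starting stages, seen through \<open>f\<close>, is of order
      \<open>CARD('s) + 2\<close> and stays separate from the defect of the weights on the exact
      solution.\<close>
    define e where "e h = f_at_nodes f c tn h (at_nodes y c tn h) - f_at_nodes f c tn h (Y h)" for h
    obtain L where "\<forall>x\<in>{t0..t0+T}. L-lipschitz_on UNIV (f x)"
      using assms(2) unfolding ivp_rhs_def by blast
    then have e: "(\<lambda>h. norm (e h)) \<in> O[H](\<lambda>h. h ^ (CARD('s) + 2))"
      unfolding e_def
      using f_at_nodes_lipschitz_bigo[where X = "{t0..t0+T}" and L = L and f = f and c = c and t = tn and F = H
          and Z = "at_nodes y c tn" and Y = Y] Y nodes_in by simp
    have stage: "eventually (\<lambda>h. \<forall>\<beta>. \<beta> \<bullet> f_at_nodes f c tn h (Y h)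
        = \<beta> \<bullet> at_nodes (D 2) c tn h - \<beta> \<bullet> e h) H"
      using nodes_in
    proof eventually_elim
      case (elim h)
      then have "f_at_nodes f c tn h (Y h) = at_nodes (D 2) c tn h - e h"
        by (auto simp: e_def vec_eq_iff f_at_nodes_def at_nodes_def D_y)
      then show ?case by (simp add: inner_diff_right)
    qed
    have D_tn: "D 0 tn = y tn" "D 1 tn = y' tn"
      using D_y t by blast+
    have qb_D: "eventually (\<lambda>h. h ^ 2 * qb D h = y (tn + h) - y tn - h * y' tn) H"
      using pos inI1 by eventually_elim (simp add: qb_def D_y(1) D_tn[simplified])
    have qd_D: "eventually (\<lambda>h. h * qd D h = y' (tn + h) - y' tn) H"
      using pos inI1 by eventually_elim (simp add: qd_def D_y(2)[simplified] D_tn[simplified])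
    have qA_D: "eventually (\<lambda>h. h ^ 2 * qA i D h
        = y (tn + h + c $ i * h) - y (tn + h) - h * c $ i * y' (tn + h)) H" for i
      using pos inI1 inI2[of i]
      by eventually_elim (simp add: qA_def D_y(1) D_y(2)[simplified])
    \<comment> \<open>The split of \<open>CARD('s) + 2\<close> is \<open>m = 2\<close>,
      \<open>k = CARD('s)\<close> for \<open>b\<close> and the rows of \<open>A\<close>, and
      \<open>m = 1\<close>, \<open>k = CARD('s) + 1\<close> for \<open>d\<close>.\<close>
    have combine: "(\<lambda>h. h ^ m * r h + h ^ m * (\<beta> h \<bullet> e h)) \<in> O[H](\<lambda>h. h ^ (CARD('s) + 2))"
      if "m + k = CARD('s) + 2" "(\<lambda>h. norm (\<beta> h)) \<in> O[H](\<lambda>_. 1)" "r \<in> O[H](\<lambda>h. h ^ k)" for m k r \<beta>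
      by (rule sum_in_bigo(1)[OF power_mult_bigo(1)[OF H_le that(3), of m, unfolded that(1)]
            power_mult_bigo(2)[OF H_le inner_bigo[OF that(2) e]]])
    have y1: "(\<lambda>h. y (tn + h) - step_y f c (b tn h) tn h (y tn) (y' tn) (Y h)) \<in> O[H](\<lambda>h. h ^ (CARD('s) + 2))"
    proof -
      have "eventually (\<lambda>h. h ^ 2 * (qb D h - b tn h \<bullet> at_nodes (D 2) c tn h) + h ^ 2 * (b tn h \<bullet> e h)
          = y (tn + h) - step_y f c (b tn h) tn h (y tn) (y' tn) (Y h)) H"
        using stage qb_D by eventually_elim (simp add: step_y_def right_diff_distrib)
      from landau_o.big.in_cong[OF this] combine[OF _ fit_b(1) fit_b(2)[OF D]] show ?thesis
        by simp
    qed
    \<comment> \<open>The prefactor is only \<open>h\<close>, so the improved order from the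
      integral condition on the nodes supplies the missing power.\<close>
    have y2: "(\<lambda>h. y' (tn + h) - step_y' f c (d tn h) tn h (y' tn) (Y h)) \<in> O[H](\<lambda>h. h ^ (CARD('s) + 2))"
    proof -
      have "eventually (\<lambda>h. h ^ 1 * (qd D h - d tn h \<bullet> at_nodes (D 2) c tn h) + h ^ 1 * (d tn h \<bullet> e h)
          = y' (tn + h) - step_y' f c (d tn h) tn h (y' tn) (Y h)) H"
        using stage qd_D by eventually_elim (simp add: step_y'_def right_diff_distrib)
      from landau_o.big.in_cong[OF this]
        combine[OF _ fit_d(1) fit_d(3)[OF D superconvergence_condition[OF assms(11)]]]
      show ?thesis by simp
    qed
    have "(\<lambda>h. norm (at_nodes y c (tn + h) h
        - step_Y f c (A tn h) (b tn h) (d tn h) tn h (y tn) (y' tn) (Y h))) \<in> O[H](\<lambda>h. h ^ (CARD('s) + 2))"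
    proof (rule norm_vec_bigo)
      fix i
      \<comment> \<open>The new stage is built on the computed values at \<open>tn + h\<close>. Its
        error is therefore its own defect plus the error of the new \<open>y\<close> and
        \<open>c $ i * h\<close> times the error of the new \<open>y'\<close>.\<close>
      have eq: "eventually (\<lambda>h. (h ^ 2 * (qA i D h - row i (A tn h) \<bullet> at_nodes (D 2) c tn h)
            + h ^ 2 * (row i (A tn h) \<bullet> e h))
          + ((y (tn + h) - step_y f c (b tn h) tn h (y tn) (y' tn) (Y h))
          + c $ i * (h ^ 1 * (y' (tn + h) - step_y' f c (d tn h) tn h (y' tn) (Y h))))
          = (at_nodes y c (tn + h) h
            - step_Y f c (A tn h) (b tn h) (d tn h) tn h (y tn) (y' tn) (Y h)) $ i) H"
        using stage qA_D[of i]
      proof eventually_elim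
        case (elim h)
        have a1: "(A tn h *v f_at_nodes f c tn h (Y h)) $ i
            = row i (A tn h) \<bullet> at_nodes (D 2) c tn h - row i (A tn h) \<bullet> e h"
          using elim(1) by (simp add: matrix_vector_mul_component row_def)
        have a2: "at_nodes y c (tn + h) h $ i = y (tn + h + c $ i * h)"
          by (simp add: at_nodes_def nodes_def)
        show ?case
          unfolding step_Y_def vector_minus_component vector_add_component vector_scaleR_component
            vec_component a1 a2 right_diff_distrib elim(2)
          by (simp add: algebra_simps)
      qed
      have "(\<lambda>h. (h ^ 2 * (qA i D h - row i (A tn h) \<bullet> at_nodes (D 2) c tn h)
            + h ^ 2 * (row i (A tn h) \<bullet> e h))
          + ((y (tn + h) - step_y f c (b tn h) tn h (y tn) (y' tn) (Y h))
          + c $ i * (h ^ 1 * (y' (tn + h) - step_y' f c (d tn h) tn h (y' tn) (Y h)))))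
          \<in> O[H](\<lambda>h. h ^ (CARD('s) + 2))"
        by (intro sum_in_bigo(1)[OF combine[OF _ fit_A(1) fit_A(2)[OF D]] sum_in_bigo(1)[OF y1]]
            cmult_in_bigo_iff[THEN iffD2] disjI2 power_mult_bigo(2)[OF H_le y2]) simp
      with landau_o.big.in_cong[OF eq] show "(\<lambda>h. (at_nodes y c (tn + h) h
            - step_Y f c (A tn h) (b tn h) (d tn h) tn h (y tn) (y' tn) (Y h)) $ i)
          \<in> O[H](\<lambda>h. h ^ (CARD('s) + 2))"
        by blast
    qed
    moreover note y1 y2
    ultimately show "(\<lambda>h. y (tn + h) - step_y f c (b tn h) tn h (y tn) (y' tn) (Y h)) \<in> O[H](\<lambda>h. h ^ (CARD('s) + 1 + 1))"
      "(\<lambda>h. y' (tn + h) - step_y' f c (d tn h) tn h (y' tn) (Y h)) \<in> O[H](\<lambda>h. h ^ (CARD('s) + 1 + 1))"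
      "(\<lambda>h. norm (at_nodes y c (tn + h) h
        - step_Y f c (A tn h) (b tn h) (d tn h) tn h (y tn) (y' tn) (Y h))) \<in> O[H](\<lambda>h. h ^ (CARD('s) + 1 + 1))"
      by simp_all
  qed
  show ?thesis
    unfolding has_orders_at_def Let_def
    \<comment> \<open>All three exponents \<open>p1\<close>, \<open>p2\<close> and \<open>p3\<close>
      are taken equal, so both minima collapse to the claimed order.\<close>
    by (intro exI[where x = "CARD('s) + 1"]) (use main in \<open>auto simp: H_def\<close>)
qed

end
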